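(* Let $G$ be a finite connected undirected multigraph with vertices $v_1,\dots,v_n$, $q=v_n$, Laplacian matrix $L$ and reduced Laplacian $\tilde L$. Let $D\in\mathrm{Div}(G)$ have degree $0$, and let \[\mathcal{K}_D=\{(f,t)\in\mathbb{R}^{n-1}\times\mathbb{R}: L\tbinom{f}{0}+t\,q\ge -D\}\subset\mathbb{R}^{n}.\] Then $\mathcal{K}_D$ is a rational simplicial $n$-cone with apex $p=(\tilde L^{-1}(-D|_{q=0}),0)$, and: (1) The map $\psi_D:\mathcal{K}_D\cap\mathbb{Z}^n\to\mathbb{E}_{[D]}$, $(f,k)\mapsto D+kq+L\binom{f}{0}$, is a bijection. (2) The map $\psi_0$ restricts to a bijection between generating sets of integral extreme rays for $\mathcal{K}_D$ and sets of primary divisors for $G$ (i.e., sets $\{\ell_vv:v\in V\}$ with $\ell_v$ a positive integer multiple of $\operatorname{ord}_q(v)$). If $\Omega$ is a generating set of integral extreme rays for $\mathcal{K}_D$ with corresponding set of primary divisors $\mathcal{P}=\psi_0(\Omega)=\{\ell_vv\}$, and $\Pi$ is the corresponding fundamental parallelepiped, then $\psi_D$ restricts to a bijection between the integer points of $\Pi$ and the set $\mathcal{S}_{[D]}=\{E\in\mathbb{E}_{[D]}:E(v)<\ell_v\ \forall v\}$ of $[D]$-secondary divisors with respect to $\mathcal{P}$. (3) With $\Omega,\Pi$ as in (2), \[\Lambda_{[D]}(z)=\sigma_{\mathcal{K}_D}(1,\dots,1,z)=\frac{\sigma_\Pi(1,\dots,1,z)}{\prod_{\omega\in\Omega}(1-z^{\deg(\omega)})},\]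 where $\deg(\omega)$ is the sum of the coordinates of $\omega$; the numerator and denominator coincide with $\sum_{F\in\mathcal{S}_{[D]}}z^{\deg F}$ and $\prod_{v\in V}(1-z^{\ell_v})$ respectively.
   Context: Divisors on $G$ are vectors in $\mathbb{Z}^n$ indexed by the vertices, $\deg(D)=\sum D(v_i)$; $q$ also denotes the $n$-th standard basis vector. $L=\mathrm{Deg}-A$ (degree matrix minus adjacency matrix counting edges); $\tilde L$ is $L$ with the last row and column deleted (it is invertible over $\mathbb{Q}$). $D\sim D'$ iff $D-D'\in\operatorname{im}_{\mathbb{Z}}L$; $\operatorname{Jac}(G)$ is degree-$0$ divisors mod $\operatorname{im}_\mathbb{Z}L$; $D|_{q=0}\in\mathbb{Z}^{n-1}$ is $D$ with its last coordinate deleted. $|D|=\{E\ge0:E\sim D\}$, $\mathbb{E}_{[D]}=\bigcup_{k\ge0}|D+kq|$, $\operatorname{ord}_q(v)$ is the order of $[v-q]$ in $\operatorname{Jac}(G)$, $\lambda_{[D]}(k)=\#|D+kq|$, $\Lambda_{[D]}(z)=\sum_k\lambda_{[D]}(k)z^k$. An affine $n$-cone in $\mathbb{R}^n$ is a set $\{p+\sum_{i=1}^m\lambda_i\omega_i:\lambda_i\ge0\}$ with the $\omega_i$ (generators) spanning $\mathbb{R}^n$; it is rational if $p,\omega_i\in\mathbb{Q}^n$; a generator that is not a nonnegative combination of the others is an extreme ray; the cone is simplicial if it can be written with $n$ generators, and $p$ is then its apex. For a simplicial cone with integral generating set $\Omega=\{\omega_1,\dots,\omega_n\}$ and apex $p$,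 the fundamental parallelepiped is $\Pi=\{p+\sum\lambda_i\omega_i:0\le\lambda_i<1\}$. The integer-point transform of $S\subset\mathbb{R}^n$ is $\sigma_S(z_1,\dots,z_n)=\sum_{\alpha\in S\cap\mathbb{Z}^n}\prod_iz_i^{\alpha_i}$.
   Formalization: In (3), deg(ω) is taken as the coordinate sum of the divisor ψ_0(ω) (the last coordinate of ω), not of ω itself; with the latter the formula fails for two vertices joined by one edge, D=0, Ω={(0,1),(1,1)}, where Λ=1/(1−z)^2. *)

theory Defs
  imports
    "Jordan_Normal_Form.Gauss_Jordan_Elimination"
    "Jordan_Normal_Form.Determinant"
    "HOL-Library.Multiset"
    "HOL-Algebra.Multiplicative_Group"
    "HOL-Analysis.Infinite_Sum"
begin

text \<open>
  A multigraph is given by its number \<open>n\<close> of vertices and its multiset \<open>E\<close> of edges. The vertices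
  \<open>v\<^sub>1, \<dots>, v\<^sub>n\<close> are the numbers \<open>0, \<dots>, n - 1\<close>, and \<open>q\<close> is the vertex \<open>n - 1\<close>. An edge is an unordered
  pair \<open>{u, v}\<close>; a loop is a singleton. A loop is counted once in the degree and once in the
  adjacency matrix (counting it twice in both is also common), so loops cancel in the Laplacian.
\<close>

definition multigraph :: "nat \<Rightarrow> nat set multiset \<Rightarrow> bool" where
  "multigraph n E \<longleftrightarrow> (\<forall>e \<in># E. \<exists>u < n. \<exists>v < n. e = {u, v})"

definition connected_multigraph :: "nat \<Rightarrow> nat set multiset \<Rightarrow> bool" where
  "connected_multigraph n E \<longleftrightarrow> multigraph n E \<and> 0 < n \<and>
     (\<forall>u < n. \<forall>v < n. (u, v) \<in> {(i, j). {i, j} \<in># E}\<^sup>*)"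

definition degree_mat :: "nat \<Rightarrow> nat set multiset \<Rightarrow> int mat" where
  "degree_mat n E = mat n n (\<lambda>(i, j). if i = j then int (size {#e \<in># E. i \<in> e#}) else 0)"

definition adjacency_mat :: "nat \<Rightarrow> nat set multiset \<Rightarrow> int mat" where
  "adjacency_mat n E = mat n n (\<lambda>(i, j). int (count E {i, j}))"

definition laplacian :: "nat \<Rightarrow> nat set multiset \<Rightarrow> int mat" where
  "laplacian n E = degree_mat n E - adjacency_mat n E"

definition reduced_laplacian :: "nat \<Rightarrow> nat set multiset \<Rightarrow> int mat" where
  "reduced_laplacian n E = mat_delete (laplacian n E) (n - 1) (n - 1)"


definition divisors :: "nat \<Rightarrow> int vec set" where
  "divisors n = carrier_vec n"

definition div_degree :: "int vec \<Rightarrow> int" where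
  "div_degree D = (\<Sum>i < dim_vec D. D $ i)"

definition vertex_divisor :: "nat \<Rightarrow> nat \<Rightarrow> int vec" where
  "vertex_divisor n v = unit_vec n v"

definition q_divisor :: "nat \<Rightarrow> int vec" where
  "q_divisor n = vertex_divisor n (n - 1)"

definition laplacian_image :: "nat \<Rightarrow> nat set multiset \<Rightarrow> int vec set" where
  "laplacian_image n E = {laplacian n E *\<^sub>v f | f. f \<in> carrier_vec n}"

definition lin_equiv :: "nat \<Rightarrow> nat set multiset \<Rightarrow> int vec \<Rightarrow> int vec \<Rightarrow> bool" where
  "lin_equiv n E D D' \<longleftrightarrow> D - D' \<in> laplacian_image n E"

definition degree_zero_group :: "nat \<Rightarrow> int vec monoid" where
  "degree_zero_group n =
     \<lparr>carrier = {D \<in> divisors n. div_degree D = 0}, mult = (+), one = 0\<^sub>v n\<rparr>"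

definition jacobian :: "nat \<Rightarrow> nat set multiset \<Rightarrow> int vec set monoid" where
  "jacobian n E = degree_zero_group n Mod laplacian_image n E"

definition ord_q :: "nat \<Rightarrow> nat set multiset \<Rightarrow> nat \<Rightarrow> nat" where
  "ord_q n E v = group.ord (jacobian n E)
     (laplacian_image n E #>\<^bsub>degree_zero_group n\<^esub> (vertex_divisor n v - q_divisor n))"

definition linear_system :: "nat \<Rightarrow> nat set multiset \<Rightarrow> int vec \<Rightarrow> int vec set" where
  "linear_system n E D = {F \<in> divisors n. 0\<^sub>v n \<le> F \<and> lin_equiv n E F D}"

definition effective_class :: "nat \<Rightarrow> nat set multiset \<Rightarrow> int vec \<Rightarrow> int vec set" where
  "effective_class n E D = (\<Union>k::nat. linear_system n E (D + int k \<cdot>\<^sub>v q_divisor n))"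

definition Lambda_series :: "nat \<Rightarrow> nat set multiset \<Rightarrow> int vec \<Rightarrow> rat fps" where
  "Lambda_series n E D =
     Abs_fps (\<lambda>k. of_nat (card (linear_system n E (D + int k \<cdot>\<^sub>v q_divisor n))))"

definition primary_multiplicities :: "nat \<Rightarrow> nat set multiset \<Rightarrow> (nat \<Rightarrow> nat) \<Rightarrow> bool" where
  "primary_multiplicities n E l \<longleftrightarrow> (\<forall>v < n. 0 < l v \<and> ord_q n E v dvd l v)"

definition primary_set :: "nat \<Rightarrow> (nat \<Rightarrow> nat) \<Rightarrow> int vec set" where
  "primary_set n l = (\<lambda>v. int (l v) \<cdot>\<^sub>v vertex_divisor n v) ` {..<n}"

definition secondary_divisors ::
  "nat \<Rightarrow> nat set multiset \<Rightarrow> int vec \<Rightarrow> (nat \<Rightarrow> nat) \<Rightarrow> int vec set" where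
  "secondary_divisors n E D l = {F \<in> effective_class n E D. \<forall>v < n. F $ v < int (l v)}"


definition lin_comb :: "nat \<Rightarrow> (real vec \<Rightarrow> real) \<Rightarrow> real vec set \<Rightarrow> real vec" where
  "lin_comb n c \<Omega> = vec n (\<lambda>j. \<Sum>\<omega> \<in> \<Omega>. c \<omega> * \<omega> $ j)"

definition affine_cone :: "nat \<Rightarrow> real vec \<Rightarrow> real vec set \<Rightarrow> real vec set \<Rightarrow> bool" where
  "affine_cone n p \<Omega> K \<longleftrightarrow>
     p \<in> carrier_vec n \<and> finite \<Omega> \<and> \<Omega> \<subseteq> carrier_vec n \<and>
     range (\<lambda>c. lin_comb n c \<Omega>) = carrier_vec n \<and>
     K = {p + lin_comb n c \<Omega> | c. \<forall>\<omega> \<in> \<Omega>. 0 \<le> c \<omega>}"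

definition rational_vec :: "real vec \<Rightarrow> bool" where
  "rational_vec x \<longleftrightarrow> (\<forall>i < dim_vec x. x $ i \<in> \<rat>)"

definition rational_simplicial_cone :: "nat \<Rightarrow> real vec \<Rightarrow> real vec set \<Rightarrow> bool" where
  "rational_simplicial_cone n p K \<longleftrightarrow>
     rational_vec p \<and>
     (\<exists>\<Omega>. affine_cone n p \<Omega> K \<and> card \<Omega> = n \<and> (\<forall>\<omega> \<in> \<Omega>. rational_vec \<omega>))"

definition extreme_generator :: "nat \<Rightarrow> real vec set \<Rightarrow> real vec \<Rightarrow> bool" where
  "extreme_generator n \<Omega> \<omega> \<longleftrightarrow>
     \<not> (\<exists>c. (\<forall>\<nu> \<in> \<Omega> - {\<omega>}. 0 \<le> c \<nu>) \<and> \<omega> = lin_comb n c (\<Omega> - {\<omega>}))"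

abbreviation real_vec :: "int vec \<Rightarrow> real vec" where
  "real_vec \<equiv> map_vec real_of_int"

definition integral_extreme_generators :: "nat \<Rightarrow> real vec set \<Rightarrow> int vec set \<Rightarrow> bool" where
  "integral_extreme_generators n K \<Omega> \<longleftrightarrow>
     (\<exists>p. affine_cone n p (real_vec ` \<Omega>) K) \<and>
     (\<forall>\<omega> \<in> \<Omega>. extreme_generator n (real_vec ` \<Omega>) (real_vec \<omega>))"

definition fundamental_parallelepiped ::
  "nat \<Rightarrow> real vec \<Rightarrow> int vec set \<Rightarrow> real vec set" where
  "fundamental_parallelepiped n p \<Omega> =
     {p + lin_comb n c (real_vec ` \<Omega>) | c. \<forall>\<omega> \<in> real_vec ` \<Omega>. 0 \<le> c \<omega> \<and> c \<omega> < 1}"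

definition integer_points :: "real vec set \<Rightarrow> int vec set" where
  "integer_points S = {\<alpha>. real_vec \<alpha> \<in> S}"

text \<open>
  The transform is defined for arguments in any commutative topological ring in which the sum makes
  sense. It is used below in \<open>\<rat>[[z]]\<close> with its \<open>z\<close>-adic topology, at \<open>(1, \<dots>, 1, z)\<close>; there the
  exponents of \<open>z\<close> are nonnegative for all the sets considered.
\<close>

definition integer_point_transform ::
  "nat \<Rightarrow> real vec set \<Rightarrow> (nat \<Rightarrow> 'a) \<Rightarrow> 'a :: {comm_ring_1, inverse, t2_space}" where
  "integer_point_transform n S z = (\<Sum>\<^sub>\<infinity>\<alpha> \<in> integer_points S. \<Prod>i < n. z i powi (\<alpha> $ i))"

definition ones_z :: "nat \<Rightarrow> nat \<Rightarrow> rat fps" where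
  "ones_z n i = (if i = n - 1 then fps_X else 1)"


definition snoc_vec :: "'a vec \<Rightarrow> 'a \<Rightarrow> 'a vec" where
  "snoc_vec f t = f @\<^sub>v vec 1 (\<lambda>_. t)"

definition cone_K :: "nat \<Rightarrow> nat set multiset \<Rightarrow> int vec \<Rightarrow> real vec set" where
  "cone_K n E D = {snoc_vec f t | f t. f \<in> carrier_vec (n - 1) \<and>
     - real_vec D \<le>
       map_mat real_of_int (laplacian n E) *\<^sub>v snoc_vec f 0 + t \<cdot>\<^sub>v real_vec (q_divisor n)}"

definition cone_apex :: "nat \<Rightarrow> nat set multiset \<Rightarrow> int vec \<Rightarrow> real vec" where
  "cone_apex n E D = snoc_vec
     (the (mat_inverse (map_mat real_of_int (reduced_laplacian n E))) *\<^sub>v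
        (- real_vec (vec_first D (n - 1)))) 0"

definition psi :: "nat \<Rightarrow> nat set multiset \<Rightarrow> int vec \<Rightarrow> int vec \<Rightarrow> int vec" where
  "psi n E D x = D + (x $ (n - 1)) \<cdot>\<^sub>v q_divisor n
     + laplacian n E *\<^sub>v snoc_vec (vec_first x (n - 1)) 0"

text \<open>
  The degree of a ray \<open>\<omega> = (f, k)\<close> is the coordinate sum of the divisor \<open>\<psi>\<^sub>0(\<omega>)\<close> that it corresponds
  to, which is \<open>k\<close>. The coordinate sum of the vector \<open>(f, k)\<close> itself is a different number, for which
  the formula for the generating function fails: for two vertices joined by one edge the primitive
  rays are \<open>(1, 1)\<close> and \<open>(0, 1)\<close>, both of degree 1.
\<close>

definition ray_degree :: "nat \<Rightarrow> nat set multiset \<Rightarrow> int vec \<Rightarrow> int" where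
  "ray_degree n E \<omega> = div_degree (psi n E (0\<^sub>v n) \<omega>)"

end

theory Submission
  imports Defs
begin

text \<open>
  The linear map \<open>\<Phi>(f, t) = L (f, 0) + t q\<close> is an automorphism of \<open>\<real>\<^sup>n\<close>, because the kernel of \<open>L\<close> on a
  connected graph consists of the constants and the coordinate sum of \<open>\<Phi>(f, t)\<close> is \<open>t\<close>. It maps
  \<open>\<K>\<^sub>D\<close> onto the translated orthant \<open>-D + \<real>\<^sup>n\<^sub>\<ge>\<^sub>0\<close>, and \<open>\<psi>\<^sub>D = D + \<Phi>\<close>. So the apex is \<open>\<Phi>\<inverse>(-D)\<close>, the
  extreme rays are the preimages of the coordinate axes, and \<open>l v\<close> is the image of an integer point if
  and only if \<open>l (v - q)\<close> lies in the image of \<open>L\<close>, that is, if and only if the order of \<open>v - q\<close>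
  divides \<open>l\<close>. For the generating function, let \<open>A\<^sub>m\<close> be the set of effective divisors of the class
  with \<open>F(v) < \<ell>\<^sub>v\<close> for the first \<open>m\<close> vertices \<open>v\<close>. The shift by \<open>\<ell>\<^sub>w w\<close>, where \<open>w\<close> is the next
  vertex, maps \<open>A\<^sub>m\<close> injectively into itself with complement \<open>A\<^sub>m\<^sub>+\<^sub>1\<close>; hence passing from \<open>A\<^sub>m\<close> to
  \<open>A\<^sub>m\<^sub>+\<^sub>1\<close> multiplies the series by \<open>1 - z^\<ell>\<^sub>w\<close>.
\<close>

section \<open>The Laplacian of a connected multigraph\<close>

text \<open>Coordinates of a matrix-vector product stay atomic under simplification; where needed
  they are expanded as sums over \<open>{..<n}\<close> through
  \<open>mat_mult_vec_index\<close>.\<close>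

declare index_mult_mat_vec [simp del]

text \<open>An edge containing \<open>i\<close> is \<open>{i, w}\<close> for exactly one vertex
  \<open>w\<close>, with \<open>w = i\<close> for a loop. Sorting the edges at \<open>i\<close> by
  \<open>w\<close> therefore counts each of them once, in accordance with the convention on
  loops.\<close>

lemma degree_eq_sum_count:
  assumes "multigraph n E" and "i < n"
  shows "size {#e \<in># E. i \<in> e#} = (\<Sum>j<n. count E {i, j})"
  using assms(1)
proof (induction E)
  case empty
  then show ?case by simp
next
  case (add e E)
  then obtain u v where uv: "u < n" "v < n" "e = {u, v}"
    unfolding multigraph_def by auto
  have "(\<Sum>j<n. if {i, j} = e then 1 else 0 :: nat) = (if i \<in> e then 1 else 0)"
  proof (cases "i \<in> e")
    case True
    then obtain w where w: "w < n" "e = {i, w}"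
      using uv by auto
    have "(\<Sum>j<n. if {i, j} = e then 1 else 0 :: nat) = (\<Sum>j<n. if j = w then 1 else 0)"
      using w by (intro sum.cong) (auto simp: doubleton_eq_iff)
    then show ?thesis using w True by simp
  qed (auto intro!: sum.neutral)
  moreover have "(\<Sum>j<n. count (add_mset e E) {i, j}) =
      (\<Sum>j<n. count E {i, j}) + (\<Sum>j<n. if {i, j} = e then 1 else 0 :: nat)"
    by (subst sum.distrib [symmetric]) (auto intro!: sum.cong)
  moreover have "multigraph n E"
    using add.prems by (auto simp: multigraph_def)
  ultimately show ?case
    using add.IH by (cases "i \<in> e") simp_all
qed

lemma laplacian_carrier [simp]:
  "laplacian n E \<in> carrier_mat n n" "dim_row (laplacian n E) = n" "dim_col (laplacian n E) = n"
  by (auto simp: laplacian_def degree_mat_def adjacency_mat_def)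

lemma laplacian_index:
  assumes "i < n" "j < n"
  shows "laplacian n E $$ (i, j) =
    (if i = j then int (size {#e \<in># E. i \<in> e#}) else 0) - int (count E {i, j})"
  using assms by (simp add: laplacian_def degree_mat_def adjacency_mat_def)

lemma mat_mult_vec_index:
  assumes "A \<in> carrier_mat m n" "x \<in> carrier_vec n" "i < m"
  shows "(A *\<^sub>v x) $ i = (\<Sum>j<n. A $$ (i, j) * x $ j)"
  using assms by (auto simp: index_mult_mat_vec scalar_prod_def lessThan_atLeast0 intro!: sum.cong)

text \<open>Splitting the degree by the other endpoint turns a row of the Laplacian into weighted
  differences. This form shows that constants lie in the kernel and suits the maximum principle; it
  is generic in the ring to cover real and integral vectors alike.\<close>

lemma laplacian_mult_vec_index:
  fixes g :: "'a :: comm_ring_1 vec"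
  assumes "multigraph n E" and "i < n" and g: "g \<in> carrier_vec n"
  shows "(map_mat of_int (laplacian n E) *\<^sub>v g) $ i =
    (\<Sum>j<n. of_nat (count E {i, j}) * (g $ i - g $ j))"
proof -
  have "(map_mat of_int (laplacian n E) *\<^sub>v g) $ i =
      (\<Sum>j<n. of_int (laplacian n E $$ (i, j)) * g $ j)"
    using assms by (subst mat_mult_vec_index [of _ n n]) auto
  also have "\<dots> = (\<Sum>j<n. (if i = j then of_nat (size {#e \<in># E. i \<in> e#}) * g $ i else 0)
      - of_nat (count E {i, j}) * g $ j)"
    using assms by (intro sum.cong) (auto simp: laplacian_index algebra_simps)
  also have "\<dots> = of_nat (size {#e \<in># E. i \<in> e#}) * g $ i - (\<Sum>j<n. of_nat (count E {i, j}) * g $ j)"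
    using assms by (simp add: sum_subtractf)
  also have "\<dots> = (\<Sum>j<n. of_nat (count E {i, j}) * (g $ i - g $ j))"
    using assms by (simp add: degree_eq_sum_count algebra_simps sum_subtractf sum_distrib_left)
  finally show ?thesis .
qed

text \<open>The multiplicity of \<open>{i, j}\<close> is symmetric in \<open>i\<close> and
  \<open>j\<close>, so the two double sums that come from the differences cancel.\<close>

lemma sum_laplacian_mult_vec:
  fixes g :: "'a :: comm_ring_1 vec"
  assumes "multigraph n E" and g: "g \<in> carrier_vec n"
  shows "(\<Sum>i<n. (map_mat of_int (laplacian n E) *\<^sub>v g) $ i) = 0"
proof -
  have "(\<Sum>i<n. (map_mat of_int (laplacian n E) *\<^sub>v g) $ i) =
      (\<Sum>i<n. \<Sum>j<n. of_nat (count E {i, j}) * g $ i) - (\<Sum>i<n. \<Sum>j<n. of_nat (count E {i, j}) * g $ j)"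
    using assms by (simp add: laplacian_mult_vec_index right_diff_distrib sum_subtractf)
  also have "(\<Sum>i<n. \<Sum>j<n. of_nat (count E {i, j}) * g $ j) =
      (\<Sum>j<n. \<Sum>i<n. of_nat (count E {i, j}) * g $ j)"
    by (rule sum.swap)
  also have "\<dots> = (\<Sum>i<n. \<Sum>j<n. of_nat (count E {i, j}) * g $ i)"
    by (subst insert_commute) (rule refl)
  finally show ?thesis
    by simp
qed

text \<open>Maximum principle: at a maximum of a harmonic function all neighbours are maxima too.\<close>

lemma laplacian_kernel_const:
  fixes g :: "real vec"
  assumes "connected_multigraph n E" and g: "g \<in> carrier_vec n"
    and ker: "map_mat of_int (laplacian n E) *\<^sub>v g = 0\<^sub>v n"
    and "u < n" "v < n"
  shows "g $ u = g $ v"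
proof -
  have mg: "multigraph n E" and n: "0 < n"
    and conn: "\<And>u v. u < n \<Longrightarrow> v < n \<Longrightarrow> (u, v) \<in> {(i, j). {i, j} \<in># E}\<^sup>*"
    using assms(1) by (auto simp: connected_multigraph_def)
  define M where "M = Max ((\<lambda>i. g $ i) ` {..<n})"
  have le: "g $ i \<le> M" if "i < n" for i
    unfolding M_def using that by (intro Max_ge) auto
  have "M \<in> (\<lambda>i. g $ i) ` {..<n}"
    unfolding M_def using n by (intro Max_in) auto
  then obtain a where a: "a < n" "g $ a = M"
    by auto
  have max_nb: "j < n \<and> g $ j = M" if "i < n" "g $ i = M" "{i, j} \<in># E" for i j
  proof -
    have j: "j < n"
      using mg that(3) by (fastforce simp: multigraph_def doubleton_eq_iff)
    \<comment> \<open>At a maximum all summands of the \<open>i\<close>-th coordinate are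
      nonnegative. They add up to 0, so each of them vanishes, in particular the one for the
      neighbour \<open>j\<close>.\<close>
    have nn: "0 \<le> real (count E {i, j}) * (g $ i - g $ j)" if "j < n" for j
      using le [OF that] \<open>g $ i = M\<close> by simp
    have "(\<Sum>j<n. real (count E {i, j}) * (g $ i - g $ j)) = 0"
      using laplacian_mult_vec_index [OF mg that(1) g] ker that(1) by simp
    then have "real (count E {i, j}) * (g $ i - g $ j) = 0"
      using nn j by (subst (asm) sum_nonneg_eq_0_iff) auto
    then show ?thesis
      using that j by (simp add: count_eq_zero_iff)
  qed
  have "w < n \<and> g $ w = M" if "(a, w) \<in> {(i, j). {i, j} \<in># E}\<^sup>*" for w
    using that
  proof (induction rule: rtrancl_induct)
    case base
    then show ?case using a by blast
  next
    case (step y z)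
    then show ?case using max_nb by blast
  qed
  then have "g $ u = M" "g $ v = M"
    using conn a(1) assms(4,5) by blast+
  then show ?thesis
    by simp
qed

section \<open>The coordinates \<open>(f, t)\<close> and the injectivity of \<Phi>\<close>

lemma snoc_vec_carrier [simp]:
  "0 < n \<Longrightarrow> f \<in> carrier_vec (n - 1) \<Longrightarrow> snoc_vec f t \<in> carrier_vec n"
  by (rule carrier_vecI) (auto simp: snoc_vec_def)

lemma snoc_vec_index:
  assumes "0 < n" "f \<in> carrier_vec (n - 1)" "i < n"
  shows "snoc_vec f t $ i = (if i = n - 1 then t else f $ i)"
  using assms by (auto simp: snoc_vec_def)

lemma snoc_vec_first:
  assumes "0 < n" "x \<in> carrier_vec n"
  shows "snoc_vec (vec_first x (n - 1)) (x $ (n - 1)) = x"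
proof (rule eq_vecI)
  fix i assume "i < dim_vec x"
  then show "snoc_vec (vec_first x (n - 1)) (x $ (n - 1)) $ i = x $ i"
    using assms by (cases "i = n - 1") (auto simp: snoc_vec_index [of n] vec_first_def)
qed (use assms in \<open>auto simp: snoc_vec_def\<close>)

text \<open>The matrix of the linear map \<open>(f, t) \<mapsto> L (f, 0) + t q\<close>.\<close>

definition cone_mat :: "nat \<Rightarrow> nat set multiset \<Rightarrow> int mat" where
  "cone_mat n E = mat n n (\<lambda>(i, j).
     if j = n - 1 then if i = n - 1 then 1 else 0 else laplacian n E $$ (i, j))"

lemma cone_mat_carrier [simp]:
  "cone_mat n E \<in> carrier_mat n n" "dim_row (cone_mat n E) = n" "dim_col (cone_mat n E) = n"
  by (auto simp: cone_mat_def)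

text \<open>The last column of the Laplacian has been replaced by \<open>q\<close>: the last entry
  \<open>t\<close> contributes \<open>t q\<close>, and the other columns act as the Laplacian does
  on \<open>f\<close> extended by 0.\<close>

lemma cone_mat_mult_snoc:
  fixes f :: "'a :: comm_ring_1 vec"
  assumes n: "0 < n" and f: "f \<in> carrier_vec (n - 1)"
  shows "map_mat of_int (cone_mat n E) *\<^sub>v snoc_vec f t =
    map_mat of_int (laplacian n E) *\<^sub>v snoc_vec f 0 + t \<cdot>\<^sub>v unit_vec n (n - 1)"
proof (rule eq_vecI)
  fix i assume "i < dim_vec (map_mat of_int (laplacian n E) *\<^sub>v snoc_vec f 0 + t \<cdot>\<^sub>v unit_vec n (n - 1))"
  then have i: "i < n"
    by simp
  have split: "{..<n} = insert (n - 1) {..<n - 1}"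
    using n by auto
  show "(map_mat of_int (cone_mat n E) *\<^sub>v snoc_vec f t) $ i =
      (map_mat of_int (laplacian n E) *\<^sub>v snoc_vec f 0 + t \<cdot>\<^sub>v unit_vec n (n - 1)) $ i"
    using i n f
    by (auto simp: mat_mult_vec_index [of _ n n] split snoc_vec_index [of n] cone_mat_def
        intro!: sum.cong)
qed simp

text \<open>The image of the Laplacian has coordinate sum 0 and \<open>q\<close> has coordinate sum
  1. Hence the last coordinate of a point records the degree of its image.\<close>

lemma sum_cone_mat_mult_vec:
  fixes x :: "'a :: comm_ring_1 vec"
  assumes "multigraph n E" "0 < n" "x \<in> carrier_vec n"
  shows "(\<Sum>i<n. (map_mat of_int (cone_mat n E) *\<^sub>v x) $ i) = x $ (n - 1)"
proof -
  have "map_mat of_int (cone_mat n E) *\<^sub>v x =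
      map_mat of_int (laplacian n E) *\<^sub>v snoc_vec (vec_first x (n - 1)) 0
      + x $ (n - 1) \<cdot>\<^sub>v unit_vec n (n - 1)"
    using assms by (subst cone_mat_mult_snoc [symmetric]) (auto simp: snoc_vec_first simp del: One_nat_def)
  then have "(\<Sum>i<n. (map_mat of_int (cone_mat n E) *\<^sub>v x) $ i) =
      (\<Sum>i<n. (map_mat of_int (laplacian n E) *\<^sub>v snoc_vec (vec_first x (n - 1)) 0) $ i)
      + (\<Sum>i<n. if i = n - 1 then x $ (n - 1) else 0)"
    by (subst sum.distrib [symmetric]) (auto intro!: sum.cong)
  then show ?thesis
    using assms by (simp add: sum_laplacian_mult_vec)
qed

lemma laplacian_snoc_kernel:
  fixes f :: "real vec"
  assumes "connected_multigraph n E" "f \<in> carrier_vec (n - 1)"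
    and "map_mat of_int (laplacian n E) *\<^sub>v snoc_vec f 0 = 0\<^sub>v n"
  shows "f = 0\<^sub>v (n - 1)"
proof (rule eq_vecI)
  fix i assume "i < dim_vec (0\<^sub>v (n - 1) :: real vec)"
  then have i: "i < n - 1"
    by simp
  then have "snoc_vec f 0 $ i = (snoc_vec f 0 :: real vec) $ (n - 1)"
    using assms by (intro laplacian_kernel_const [of n E]) auto
  then show "f $ i = 0\<^sub>v (n - 1) $ i"
    using i assms(2) by (auto simp: snoc_vec_index [of n])
qed (use assms in auto)

text \<open>The coordinate sum of the image forces the last entry of \<open>x\<close> to be 0. What
  remains is a kernel vector of the Laplacian that vanishes at \<open>q\<close>, and such a vector
  is constant.\<close>

lemma cone_mat_kernel:
  fixes x :: "real vec"
  assumes conn: "connected_multigraph n E" and x: "x \<in> carrier_vec n"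
    and ker: "map_mat of_int (cone_mat n E) *\<^sub>v x = 0\<^sub>v n"
  shows "x = 0\<^sub>v n"
proof -
  have mg: "multigraph n E" and n: "0 < n"
    using conn by (auto simp: connected_multigraph_def)
  have q: "x $ (n - 1) = 0"
    using sum_cone_mat_mult_vec [OF mg n x] ker by simp
  have zero: "0 \<cdot>\<^sub>v unit_vec n (n - 1) = (0\<^sub>v n :: real vec)"
    by (intro eq_vecI) auto
  have "map_mat of_int (laplacian n E) *\<^sub>v snoc_vec (vec_first x (n - 1)) 0
      + x $ (n - 1) \<cdot>\<^sub>v unit_vec n (n - 1) = 0\<^sub>v n"
    using ker cone_mat_mult_snoc [OF n vec_first_carrier, of E x "x $ (n - 1)"]
    by (simp only: snoc_vec_first [OF n x])
  then have "map_mat of_int (laplacian n E) *\<^sub>v snoc_vec (vec_first x (n - 1)) 0 = 0\<^sub>v n"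
    unfolding q zero by (subst (asm) right_zero_vec) (auto intro: carrier_vecI)
  then have "vec_first x (n - 1) = 0\<^sub>v (n - 1)"
    using laplacian_snoc_kernel [OF conn vec_first_carrier] by blast
  then have "x = snoc_vec (0\<^sub>v (n - 1)) 0"
    using snoc_vec_first [OF n x] q by simp
  then show ?thesis
    using n by (intro eq_vecI) (auto simp: snoc_vec_index [of n])
qed

section \<open>The reduced Laplacian\<close>

lemma reduced_laplacian_carrier:
  "reduced_laplacian n E \<in> carrier_mat (n - 1) (n - 1)"
  by (auto simp: reduced_laplacian_def mat_delete_def)

lemma reduced_laplacian_mult_vec:
  fixes f :: "'a :: comm_ring_1 vec"
  assumes n: "0 < n" and f: "f \<in> carrier_vec (n - 1)" and i: "i < n - 1"
  shows "(map_mat of_int (reduced_laplacian n E) *\<^sub>v f) $ i =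
    (map_mat of_int (laplacian n E) *\<^sub>v snoc_vec f 0) $ i"
proof -
  have split: "{..<n} = insert (n - 1) {..<n - 1}"
    using n by auto
  have "(map_mat of_int (laplacian n E) *\<^sub>v snoc_vec f 0) $ i =
      (\<Sum>j<n. of_int (laplacian n E $$ (i, j)) * snoc_vec f 0 $ j)"
    using assms by (subst mat_mult_vec_index [of _ n n]) auto
  also have "\<dots> = (\<Sum>j<n - 1. of_int (laplacian n E $$ (i, j)) * f $ j)"
    unfolding split using assms by (auto simp: snoc_vec_index [of n] intro!: sum.cong)
  also have "\<dots> = (\<Sum>j<n - 1. of_int (reduced_laplacian n E $$ (i, j)) * f $ j)"
    using assms by (auto simp: reduced_laplacian_def mat_delete_def intro!: sum.cong)
  also have "\<dots> = (map_mat of_int (reduced_laplacian n E) *\<^sub>v f) $ i"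
    using assms reduced_laplacian_carrier [of n E]
    by (subst mat_mult_vec_index [of _ "n - 1" "n - 1"]) (auto intro!: sum.cong)
  finally show ?thesis
    by (rule sym)
qed

text \<open>The first \<open>n - 1\<close> coordinates of the Laplacian applied to \<open>f\<close>
  extended by 0 vanish by assumption, and the last one follows because the coordinates sum to
  0.\<close>

lemma reduced_laplacian_kernel:
  fixes f :: "real vec"
  assumes conn: "connected_multigraph n E" and f: "f \<in> carrier_vec (n - 1)"
    and ker: "map_mat of_int (reduced_laplacian n E) *\<^sub>v f = 0\<^sub>v (n - 1)"
  shows "f = 0\<^sub>v (n - 1)"
proof -
  have mg: "multigraph n E" and n: "0 < n"
    using conn by (auto simp: connected_multigraph_def)
  let ?y = "map_mat of_int (laplacian n E) *\<^sub>v snoc_vec f 0"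
  have *: "?y $ i = 0" if "i < n - 1" for i
    using reduced_laplacian_mult_vec [OF n f that, of E] ker that by simp
  have "(\<Sum>i<n. ?y $ i) = 0"
    using mg n f by (intro sum_laplacian_mult_vec) auto
  also have "(\<Sum>i<n. ?y $ i) = (\<Sum>i<n. if i = n - 1 then ?y $ (n - 1) else 0)"
    using * by (intro sum.cong) auto
  finally have "?y $ (n - 1) = 0"
    using n by simp
  then have "?y $ i = 0" if "i < n" for i
    using * [of i] that by (cases "i = n - 1") auto
  then have "?y = 0\<^sub>v n"
    by (intro eq_vecI) auto
  then show ?thesis
    using laplacian_snoc_kernel conn f by blast
qed

section \<open>Generators of preimages of orthants\<close>

lemma lin_comb_carrier [simp]: "lin_comb n c \<Omega> \<in> carrier_vec n" "dim_vec (lin_comb n c \<Omega>) = n"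
  by (auto simp: lin_comb_def)

lemma mat_mult_lin_comb_index:
  assumes B: "B \<in> carrier_mat n n" and \<Omega>: "\<Omega> \<subseteq> carrier_vec n" and i: "i < n"
  shows "(B *\<^sub>v lin_comb n c \<Omega>) $ i = (\<Sum>\<omega>\<in>\<Omega>. c \<omega> * (B *\<^sub>v \<omega>) $ i)"
proof -
  have "(B *\<^sub>v lin_comb n c \<Omega>) $ i = (\<Sum>j<n. B $$ (i, j) * lin_comb n c \<Omega> $ j)"
    using B i by (intro mat_mult_vec_index) auto
  also have "\<dots> = (\<Sum>j<n. \<Sum>\<omega>\<in>\<Omega>. B $$ (i, j) * (c \<omega> * \<omega> $ j))"
    by (intro sum.cong) (auto simp: lin_comb_def sum_distrib_left)
  also have "\<dots> = (\<Sum>\<omega>\<in>\<Omega>. \<Sum>j<n. B $$ (i, j) * (c \<omega> * \<omega> $ j))"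
    by (rule sum.swap)
  also have "\<dots> = (\<Sum>\<omega>\<in>\<Omega>. c \<omega> * (B *\<^sub>v \<omega>) $ i)"
  proof (rule sum.cong [OF refl])
    fix \<omega> assume "\<omega> \<in> \<Omega>"
    then have "(B *\<^sub>v \<omega>) $ i = (\<Sum>j<n. B $$ (i, j) * \<omega> $ j)"
      using B i \<Omega> by (intro mat_mult_vec_index) auto
    then show "(\<Sum>j<n. B $$ (i, j) * (c \<omega> * \<omega> $ j)) = c \<omega> * (B *\<^sub>v \<omega>) $ i"
      by (simp add: sum_distrib_left algebra_simps)
  qed
  finally show ?thesis .
qed

text \<open>With the matrix of \<Phi> as \<open>B\<close> and \<open>d = - D\<close> this is the
  cone of the theorem; see \<open>cone_K_eq\<close>.\<close>

definition orthant_preimage :: "nat \<Rightarrow> real mat \<Rightarrow> real vec \<Rightarrow> real vec set" where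
  "orthant_preimage n B d = {x \<in> carrier_vec n. \<forall>i<n. d $ i \<le> (B *\<^sub>v x) $ i}"

text \<open>A trivial kernel is the form of nonsingularity that the maximum principle delivers. The
  locale is used for the matrix of \<Phi> and, in dimension \<open>n - 1\<close>, for the reduced
  Laplacian.\<close>

locale nonsingular =
  fixes n :: nat and B :: "real mat"
  assumes carrier_B: "B \<in> carrier_mat n n"
    and kernel_B: "x \<in> carrier_vec n \<Longrightarrow> B *\<^sub>v x = 0\<^sub>v n \<Longrightarrow> x = 0\<^sub>v n"
begin

lemma dim_row_B [simp]: "dim_row B = n"
  using carrier_B by auto

lemma det_B: "det B \<noteq> 0"
  using det_0_iff_vec_prod_zero_field [OF carrier_B] kernel_B by blast

text \<open>The adjugate divided by the determinant gives an explicit preimage.\<close>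

lemma mult_B_surj:
  assumes "y \<in> carrier_vec n"
  obtains x where "x \<in> carrier_vec n" "B *\<^sub>v x = y"
proof
  note adj = adj_mat [OF carrier_B]
  let ?x = "adj_mat B *\<^sub>v ((1 / det B) \<cdot>\<^sub>v y)"
  show "?x \<in> carrier_vec n"
    using adj(1) by (auto intro: carrier_vecI)
  have "B *\<^sub>v ?x = (B * adj_mat B) *\<^sub>v ((1 / det B) \<cdot>\<^sub>v y)"
    by (rule assoc_mult_mat_vec [symmetric]) (use carrier_B adj(1) assms in auto)
  also have "\<dots> = y"
  proof (rule eq_vecI)
    fix i assume "i < dim_vec y"
    then have i: "i < n" using assms by simp
    have "((B * adj_mat B) *\<^sub>v ((1 / det B) \<cdot>\<^sub>v y)) $ i =
        (\<Sum>j<n. (det B \<cdot>\<^sub>m 1\<^sub>m n) $$ (i, j) * ((1 / det B) \<cdot>\<^sub>v y) $ j)"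
      unfolding adj(2) using assms i by (intro mat_mult_vec_index) auto
    also have "\<dots> = (\<Sum>j<n. if i = j then y $ i else 0)"
      using i assms det_B by (intro sum.cong) auto
    also have "\<dots> = y $ i"
      using i by simp
    finally show "((B * adj_mat B) *\<^sub>v ((1 / det B) \<cdot>\<^sub>v y)) $ i = y $ i" .
  qed (use assms carrier_B in auto)
  finally show "B *\<^sub>v ?x = y" .
qed

lemma mult_B_inj:
  assumes "x \<in> carrier_vec n" "y \<in> carrier_vec n"
    and "\<And>i. i < n \<Longrightarrow> (B *\<^sub>v x) $ i = (B *\<^sub>v y) $ i"
  shows "x = y"
proof -
  have "B *\<^sub>v (x - y) = B *\<^sub>v x - B *\<^sub>v y"
    by (rule mult_minus_distrib_mat_vec [OF carrier_B assms(1,2)])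
  also have "\<dots> = 0\<^sub>v n"
    by (intro eq_vecI) (simp_all add: assms(3))
  finally have "B *\<^sub>v (x - y) = 0\<^sub>v n" .
  then have *: "x - y = 0\<^sub>v n"
    using assms(1,2) by (simp add: kernel_B)
  show ?thesis
  proof (rule eq_vecI)
    fix i assume "i < dim_vec y"
    then show "x $ i = y $ i"
      using arg_cong [OF *, of "\<lambda>z. z $ i"] assms(1,2) by auto
  qed (use assms(1,2) in auto)
qed

lemma invertible_B: "invertible_mat B"
proof -
  let ?C = "(1 / det B) \<cdot>\<^sub>m adj_mat B"
  note adj = adj_mat [OF carrier_B]
  have *: "(1 / det B) \<cdot>\<^sub>m (det B \<cdot>\<^sub>m 1\<^sub>m n) = (1\<^sub>m n :: real mat)"
    using det_B by (intro eq_matI) auto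
  have "B * ?C = 1\<^sub>m n" "?C * B = 1\<^sub>m n"
    using mult_smult_distrib [OF carrier_B adj(1), of "1 / det B"]
      mult_smult_assoc_mat [OF adj(1) carrier_B, of "1 / det B"] adj(2,3) * by simp_all
  moreover have "dim_row ?C = n"
    using adj(1) by simp
  ultimately show ?thesis
    unfolding invertible_mat_def inverts_mat_def using carrier_B by (metis carrier_matD square_mat.elims(3))
qed

text \<open>The vectors \<open>w v\<close> are preimages of positive multiples of the coordinate
  vectors. The multiples \<open>m v\<close> stay arbitrary, so that the results apply both to the
  preimages of the unit vectors and to integral rays.\<close>

context
  fixes w :: "nat \<Rightarrow> real vec" and m :: "nat \<Rightarrow> real" 
  assumes w: "\<And>v. v < n \<Longrightarrow> w v \<in> carrier_vec n" "\<And>v. v < n \<Longrightarrow> B *\<^sub>v w v = m v \<cdot>\<^sub>v unit_vec n v"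
    and m: "\<And>v. v < n \<Longrightarrow> 0 < m v"
begin

lemma ray_coord: "v < n \<Longrightarrow> i < n \<Longrightarrow> (B *\<^sub>v w v) $ i = (if i = v then m v else 0)"
  by (simp add: w)

lemma rays_inj: "inj_on w {..<n}"
proof (rule inj_onI)
  fix u v assume uv: "u \<in> {..<n}" "v \<in> {..<n}" and eq: "w u = w v"
  have "m u = (B *\<^sub>v w u) $ u"
    using uv by (simp add: ray_coord)
  also have "\<dots> = (if u = v then m v else 0)"
    unfolding eq using uv by (simp add: ray_coord)
  finally show "u = v"
    using m [of u] uv(1) by (cases "u = v") simp_all
qed

text \<open>After applying \<open>B\<close>, only the ray \<open>w i\<close> contributes to
  coordinate \<open>i\<close>. Proper subsets \<open>S\<close> occur in the proof of extremality,
  where one ray is left out.\<close>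

lemma lin_comb_rays_coord:
  assumes i: "i < n" and S: "S \<subseteq> {..<n}"
  shows "(B *\<^sub>v lin_comb n c (w ` S)) $ i = (if i \<in> S then c (w i) * m i else 0)"
proof -
  have "(B *\<^sub>v lin_comb n c (w ` S)) $ i = (\<Sum>\<omega>\<in>w ` S. c \<omega> * (B *\<^sub>v \<omega>) $ i)"
    using w S i by (intro mat_mult_lin_comb_index [OF carrier_B]) auto
  also have "\<dots> = (\<Sum>v\<in>S. c (w v) * (B *\<^sub>v w v) $ i)"
    using inj_on_subset [OF rays_inj S] by (simp add: sum.reindex)
  also have "\<dots> = (\<Sum>v\<in>S. if i = v then c (w i) * m i else 0)"
    using S i by (intro sum.cong) (auto simp: ray_coord)
  also have "\<dots> = (if i \<in> S then c (w i) * m i else 0)"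
    using finite_subset [OF S] by simp
  finally show ?thesis .
qed

lemma rays_span:
  assumes x: "x \<in> carrier_vec n"
  obtains c where "x = lin_comb n c (w ` {..<n})"
    and "\<And>i. i < n \<Longrightarrow> c (w i) = (B *\<^sub>v x) $ i / m i"
proof
  \<comment> \<open>Coefficients are functions of the vectors, so the index of a ray has to be
    recovered by inverting \<open>w\<close>.\<close>
  let ?c = "\<lambda>\<omega>. let i = the_inv_into {..<n} w \<omega> in (B *\<^sub>v x) $ i / m i"
  show c: "?c (w i) = (B *\<^sub>v x) $ i / m i" if "i < n" for i
    using that by (simp add: the_inv_into_f_f [OF rays_inj])
  show "x = lin_comb n ?c (w ` {..<n})"
  proof (rule mult_B_inj [OF x lin_comb_carrier(1)])
    fix i assume i: "i < n"
    show "(B *\<^sub>v x) $ i = (B *\<^sub>v lin_comb n ?c (w ` {..<n})) $ i"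
      using m [OF i] by (subst lin_comb_rays_coord [OF i order_refl]) (simp add: c [OF i] i del: Let_def)
  qed
qed

text \<open>In the basis of rays the coefficients of \<open>x - a\<close> are its rescaled
  coordinates under \<open>B\<close>. The predicate \<open>Q\<close> is \<open>0 \<le> t\<close> for
  the cone and \<open>0 \<le> t \<and> t < 1\<close> for the fundamental parallelepiped.\<close>

lemma box_eq:
  assumes a: "a \<in> carrier_vec n" "B *\<^sub>v a = d"
  shows "{a + lin_comb n c (w ` {..<n}) | c. \<forall>\<omega>\<in>w ` {..<n}. Q (c \<omega>)} =
    {x \<in> carrier_vec n. \<forall>i<n. Q (((B *\<^sub>v x) $ i - d $ i) / m i)}"
    (is "?L = ?R")
proof (rule Set.set_eqI)
  fix x
  show "x \<in> ?L \<longleftrightarrow> x \<in> ?R"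
  proof
    assume "x \<in> ?L"
    then obtain c where c: "x = a + lin_comb n c (w ` {..<n})" "\<And>i. i < n \<Longrightarrow> Q (c (w i))"
      by auto
    have "((B *\<^sub>v x) $ i - d $ i) / m i = c (w i)" if "i < n" for i
      using m [OF that] lin_comb_rays_coord [OF that order_refl, of c] a that c(1) carrier_B
      by (simp add: mult_add_distrib_mat_vec)
    then show "x \<in> ?R"
      using c a by auto
  next
    assume R: "x \<in> ?R"
    then have x: "x - a \<in> carrier_vec n" "x \<in> carrier_vec n"
      using a by auto
    from rays_span [OF x(1)] obtain c where c: "x - a = lin_comb n c (w ` {..<n})"
      "\<And>i. i < n \<Longrightarrow> c (w i) = (B *\<^sub>v (x - a)) $ i / m i" by blast
    have "(B *\<^sub>v (x - a)) $ i = (B *\<^sub>v x) $ i - d $ i" if "i < n" for i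
      using x a that carrier_B by (subst mult_minus_distrib_mat_vec) auto
    then have "Q (c (w i))" if "i < n" for i
      using R c(2) that by auto
    moreover have "x = a + lin_comb n c (w ` {..<n})"
      unfolding c(1) [symmetric] using x a by (intro eq_vecI) auto
    ultimately show "x \<in> ?L"
      by blast
  qed
qed

lemma affine_cone_rays:
  assumes a: "a \<in> carrier_vec n" "B *\<^sub>v a = d"
  shows "affine_cone n a (w ` {..<n}) (orthant_preimage n B d)"
proof -
  have "range (\<lambda>c. lin_comb n c (w ` {..<n})) = carrier_vec n"
    using rays_span by (auto simp: image_iff) metis
  moreover have "orthant_preimage n B d = {x \<in> carrier_vec n. \<forall>i<n. 0 \<le> ((B *\<^sub>v x) $ i - d $ i) / m i}"
    using m by (simp add: orthant_preimage_def pos_le_divide_eq cong: conj_cong imp_cong)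
  ultimately show ?thesis
    unfolding affine_cone_def using a w box_eq [OF a, of "\<lambda>t. 0 \<le> t"] by auto
qed

text \<open>Under \<open>B\<close>, every combination of the other rays has \<open>v\<close>-th
  coordinate 0, whereas that of \<open>w v\<close> is positive.\<close>

lemma extreme_generator_rays:
  assumes v: "v < n"
  shows "extreme_generator n (w ` {..<n}) (w v)"
  unfolding extreme_generator_def
proof
  assume "\<exists>c. (\<forall>\<nu>\<in>w ` {..<n} - {w v}. 0 \<le> c \<nu>) \<and> w v = lin_comb n c (w ` {..<n} - {w v})"
  then obtain c where "w v = lin_comb n c (w ` {..<n} - {w v})"
    by blast
  moreover have "w ` {..<n} - {w v} = w ` ({..<n} - {v})"
    using inj_on_image_set_diff [OF rays_inj, of "{..<n}" "{v}"] v by auto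
  ultimately have "w v = lin_comb n c (w ` ({..<n} - {v}))"
    by simp
  then have "(B *\<^sub>v w v) $ v = 0"
    using lin_comb_rays_coord [OF v, of "{..<n} - {v}" c] by auto
  then show False
    using ray_coord [OF v v] m [OF v] by simp
qed

end

section \<open>Arbitrary generating sets of an orthant preimage\<close>

lemma affine_cone_generator_nonneg:
  assumes cone: "affine_cone n p \<Omega> (orthant_preimage n B d)" and "\<omega> \<in> \<Omega>" and i: "i < n"
  shows "0 \<le> (B *\<^sub>v \<omega>) $ i"
proof (rule ccontr)
  assume "\<not> 0 \<le> (B *\<^sub>v \<omega>) $ i"
  then have neg: "(B *\<^sub>v \<omega>) $ i < 0" by simp
  have p: "p \<in> carrier_vec n" and fin: "finite \<Omega>" and \<Omega>: "\<Omega> \<subseteq> carrier_vec n"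
    and K: "orthant_preimage n B d = {p + lin_comb n c \<Omega> | c. \<forall>\<omega>\<in>\<Omega>. 0 \<le> c \<omega>}"
    using cone by (auto simp: affine_cone_def)
  \<comment> \<open>Moving this far along \<open>\<omega>\<close> lowers the \<open>i\<close>-th
    coordinate by one more than the distance between \<open>(B *\<^sub>v p) $ i\<close> and
    \<open>d $ i\<close>, so the point drops out of the cone.\<close>
  define t where "t = (\<bar>(B *\<^sub>v p) $ i - d $ i\<bar> + 1) / - (B *\<^sub>v \<omega>) $ i"
  have t: "0 \<le> t"
    unfolding t_def using neg by (intro divide_nonneg_pos) auto
  let ?c = "\<lambda>\<nu>. if \<nu> = \<omega> then t else 0"
  have "p + lin_comb n ?c \<Omega> \<in> orthant_preimage n B d"
    unfolding K using t by auto
  then have "d $ i \<le> (B *\<^sub>v (p + lin_comb n ?c \<Omega>)) $ i"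
    using i by (auto simp: orthant_preimage_def)
  also have "\<dots> = (B *\<^sub>v p) $ i + (\<Sum>\<nu>\<in>\<Omega>. ?c \<nu> * (B *\<^sub>v \<nu>) $ i)"
    using p i carrier_B \<Omega> by (simp add: mult_add_distrib_mat_vec mat_mult_lin_comb_index)
  also have "(\<Sum>\<nu>\<in>\<Omega>. ?c \<nu> * (B *\<^sub>v \<nu>) $ i) = t * (B *\<^sub>v \<omega>) $ i"
    using fin assms(2) by (simp add: if_distrib [of "\<lambda>x. x * _"] cong: if_cong)
  also have "t * (B *\<^sub>v \<omega>) $ i = - \<bar>(B *\<^sub>v p) $ i - d $ i\<bar> - 1"
    using neg by (simp add: t_def field_simps)
  finally show False
    by linarith
qed

text \<open>Since \<open>p\<close> lies in the cone, its image is at least \<open>d\<close>. Since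
  the preimage of \<open>d\<close> lies in the cone, \<open>d\<close> is the image of
  \<open>p\<close> plus a nonnegative combination of nonnegative vectors. So the apex is determined
  by the cone.\<close>

lemma affine_cone_apex:
  assumes cone: "affine_cone n p \<Omega> (orthant_preimage n B d)"
    and d: "d \<in> carrier_vec n"
  shows "B *\<^sub>v p = d"
proof -
  have p: "p \<in> carrier_vec n" and fin: "finite \<Omega>" and \<Omega>: "\<Omega> \<subseteq> carrier_vec n"
    and K: "orthant_preimage n B d = {p + lin_comb n c \<Omega> | c. \<forall>\<omega>\<in>\<Omega>. 0 \<le> c \<omega>}"
    using cone by (auto simp: affine_cone_def)
  obtain a where a: "a \<in> carrier_vec n" "B *\<^sub>v a = d"
    using mult_B_surj [OF d] .
  have "a \<in> orthant_preimage n B d"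
    using a by (auto simp: orthant_preimage_def)
  then obtain c where c: "a = p + lin_comb n c \<Omega>" "\<And>\<omega>. \<omega> \<in> \<Omega> \<Longrightarrow> 0 \<le> c \<omega>"
    unfolding K by auto
  have zero: "p + lin_comb n (\<lambda>_. 0) \<Omega> = p"
    using p by (intro eq_vecI) (auto simp: lin_comb_def)
  have "p + lin_comb n (\<lambda>_. 0) \<Omega> \<in> orthant_preimage n B d"
    unfolding K by (rule CollectI, rule exI [of _ "\<lambda>_. 0"]) simp
  then have pK: "p \<in> orthant_preimage n B d"
    using zero by simp
  show ?thesis
  proof (rule eq_vecI)
    fix i assume "i < dim_vec d"
    then have i: "i < n" using d by simp
    have "d = B *\<^sub>v p + B *\<^sub>v lin_comb n c \<Omega>"
      using a(2) mult_add_distrib_mat_vec [OF carrier_B p lin_comb_carrier(1), of c \<Omega>]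
      unfolding c(1) by simp
    then have "d $ i = (B *\<^sub>v p) $ i + (\<Sum>\<nu>\<in>\<Omega>. c \<nu> * (B *\<^sub>v \<nu>) $ i)"
      using i by (simp add: mat_mult_lin_comb_index [OF carrier_B \<Omega>])
    moreover have "0 \<le> (\<Sum>\<nu>\<in>\<Omega>. c \<nu> * (B *\<^sub>v \<nu>) $ i)"
      using c(2) affine_cone_generator_nonneg [OF cone _ i] by (intro sum_nonneg mult_nonneg_nonneg)
    ultimately show "(B *\<^sub>v p) $ i = d $ i"
      using pK i by (auto simp: orthant_preimage_def)
  qed (use d in auto)
qed

text \<open>Expand the point above \<open>d + unit_vec n v\<close> in the generators. All terms are
  nonnegative under \<open>B\<close> and they sum to the unit vector, so a generator with a nonzero
  term at \<open>v\<close> must vanish in every other coordinate.\<close>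

lemma affine_cone_has_ray:
  assumes cone: "affine_cone n p \<Omega> (orthant_preimage n B d)"
    and d: "d \<in> carrier_vec n" and v: "v < n"
  shows "\<exists>\<omega>\<in>\<Omega>. \<exists>m>0. B *\<^sub>v \<omega> = m \<cdot>\<^sub>v unit_vec n v"
proof -
  have p: "p \<in> carrier_vec n" and fin: "finite \<Omega>" and \<Omega>: "\<Omega> \<subseteq> carrier_vec n"
    and K: "orthant_preimage n B d = {p + lin_comb n c \<Omega> | c. \<forall>\<omega>\<in>\<Omega>. 0 \<le> c \<omega>}"
    using cone by (auto simp: affine_cone_def)
  obtain x where x: "x \<in> carrier_vec n" "B *\<^sub>v x = d + unit_vec n v"
    using mult_B_surj [of "d + unit_vec n v"] d by auto
  have "x \<in> orthant_preimage n B d"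
    using x d v by (auto simp: orthant_preimage_def)
  then obtain c where c: "x = p + lin_comb n c \<Omega>" "\<And>\<omega>. \<omega> \<in> \<Omega> \<Longrightarrow> 0 \<le> c \<omega>"
    unfolding K by auto
  have sum: "(\<Sum>\<nu>\<in>\<Omega>. c \<nu> * (B *\<^sub>v \<nu>) $ i) = unit_vec n v $ i" if i: "i < n" for i
  proof -
    have "(d + unit_vec n v) $ i = (B *\<^sub>v p + B *\<^sub>v lin_comb n c \<Omega>) $ i"
      using x(2) p carrier_B unfolding c(1) by (simp add: mult_add_distrib_mat_vec)
    then show ?thesis
      using i affine_cone_apex [OF cone d] by (simp add: mat_mult_lin_comb_index [OF carrier_B \<Omega>])
  qed
  have nonneg: "0 \<le> c \<nu> * (B *\<^sub>v \<nu>) $ i" if "\<nu> \<in> \<Omega>" "i < n" for \<nu> i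
    using c(2) affine_cone_generator_nonneg [OF cone] that by simp
  have "(\<Sum>\<nu>\<in>\<Omega>. c \<nu> * (B *\<^sub>v \<nu>) $ v) \<noteq> 0"
    using sum [OF v] v by simp
  then obtain \<omega> where \<omega>: "\<omega> \<in> \<Omega>" "c \<omega> * (B *\<^sub>v \<omega>) $ v \<noteq> 0"
    by (rule sum.not_neutral_contains_not_neutral)
  have "(B *\<^sub>v \<omega>) $ i = 0" if "i < n" "i \<noteq> v" for i
  proof -
    have "(\<Sum>\<nu>\<in>\<Omega>. c \<nu> * (B *\<^sub>v \<nu>) $ i) = 0"
      using sum [OF that(1)] that v by simp
    then have "c \<omega> * (B *\<^sub>v \<omega>) $ i = 0"
      using nonneg \<omega>(1) that(1) fin by (subst (asm) sum_nonneg_eq_0_iff) auto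
    then show ?thesis
      using \<omega>(2) by auto
  qed
  then have "B *\<^sub>v \<omega> = (B *\<^sub>v \<omega>) $ v \<cdot>\<^sub>v unit_vec n v"
    using v by (intro eq_vecI) auto
  moreover have "0 < (B *\<^sub>v \<omega>) $ v"
    using \<omega> affine_cone_generator_nonneg [OF cone \<omega>(1) v] by (cases "(B *\<^sub>v \<omega>) $ v = 0") auto
  ultimately show ?thesis
    using \<omega>(1) by blast
qed

text \<open>Choose in \<open>\<Omega>\<close> one ray for each axis. Any further generator has
  nonnegative coordinates under \<open>B\<close>, hence is a nonnegative combination of the chosen
  rays, which contradicts extremality.\<close>

lemma extreme_generators_are_rays:
  assumes cone: "affine_cone n p \<Omega> (orthant_preimage n B d)"
    and d: "d \<in> carrier_vec n"
    and ext: "\<And>\<omega>. \<omega> \<in> \<Omega> \<Longrightarrow> extreme_generator n \<Omega> \<omega>"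
  obtains w m where "\<Omega> = w ` {..<n}"
    and "\<And>v. v < n \<Longrightarrow> B *\<^sub>v w v = m v \<cdot>\<^sub>v unit_vec n v" and "\<And>v. v < n \<Longrightarrow> 0 < m v"
proof -
  have \<Omega>: "\<Omega> \<subseteq> carrier_vec n"
    using cone by (auto simp: affine_cone_def)
  obtain w where w\<Omega>: "\<And>v. v < n \<Longrightarrow> w v \<in> \<Omega>"
    and "\<And>v. v < n \<Longrightarrow> \<exists>m>0. B *\<^sub>v w v = m \<cdot>\<^sub>v unit_vec n v"
    using affine_cone_has_ray [OF cone d] by metis
  then obtain m where m: "\<And>v. v < n \<Longrightarrow> B *\<^sub>v w v = m v \<cdot>\<^sub>v unit_vec n v"
    "\<And>v. v < n \<Longrightarrow> 0 < m v"
    by metis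
  have w: "\<And>v. v < n \<Longrightarrow> w v \<in> carrier_vec n"
    using w\<Omega> \<Omega> by blast
  have "\<omega> \<in> w ` {..<n}" if \<omega>: "\<omega> \<in> \<Omega>" for \<omega>
  proof (rule ccontr)
    assume notin: "\<omega> \<notin> w ` {..<n}"
    have "\<omega> \<in> carrier_vec n"
      using \<omega> \<Omega> by blast
    from rays_span [OF w m this] obtain c where c: "\<omega> = lin_comb n c (w ` {..<n})"
      "\<And>i. i < n \<Longrightarrow> c (w i) = (B *\<^sub>v \<omega>) $ i / m i" by blast
    \<comment> \<open>Extended by 0 to the generators that were not chosen, so that the combination
      runs over all of \<open>\<Omega> - {\<omega>}\<close>.\<close>
    let ?c = "\<lambda>\<nu>. if \<nu> \<in> w ` {..<n} then c \<nu> else 0"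
    have lc: "lin_comb n ?c (\<Omega> - {\<omega>}) = lin_comb n c (w ` {..<n})"
      unfolding lin_comb_def
    proof (intro eq_vecI; simp)
      fix j assume "j < n"
      show "(\<Sum>\<nu>\<in>\<Omega> - {\<omega>}. ?c \<nu> * \<nu> $ j) = (\<Sum>\<nu>\<in>w ` {..<n}. c \<nu> * \<nu> $ j)"
        using w\<Omega> notin cone by (intro sum.mono_neutral_cong_right) (auto simp: affine_cone_def)
    qed
    have nn: "0 \<le> ?c \<nu>" for \<nu>
      using c(2) m(2) affine_cone_generator_nonneg [OF cone \<omega>] by (auto simp: zero_le_divide_iff less_imp_le)
    have "\<exists>c. (\<forall>\<nu>\<in>\<Omega> - {\<omega>}. 0 \<le> c \<nu>) \<and> \<omega> = lin_comb n c (\<Omega> - {\<omega>})"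
      by (intro exI [of _ ?c] conjI ballI nn trans [OF c(1) lc [symmetric]])
    then show False
      using ext [OF \<omega>] unfolding extreme_generator_def by blast
  qed
  then have "\<Omega> = w ` {..<n}"
    using w\<Omega> by blast
  then show ?thesis
    using that m by blast
qed

end

text \<open>Cramer's rule: \<open>det M\<close> times \<open>x\<close> equals the adjugate of
  \<open>M\<close> applied to the integral vector \<open>z\<close>.\<close>

lemma (in nonsingular) rational_vec_if_integral_image:
  assumes M: "B = map_mat real_of_int M" and x: "x \<in> carrier_vec n"
    and z: "z \<in> carrier_vec n" "B *\<^sub>v x = real_vec z"
  shows "rational_vec x"
proof -
  have Mc: "M \<in> carrier_mat n n"
    using carrier_B M by auto
  note adj = adj_mat [OF Mc]
  let ?A = "map_mat real_of_int (adj_mat M)"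
  have det: "det M \<noteq> 0"
    using det_B unfolding M by simp
  have "real_vec (adj_mat M *\<^sub>v z) = ?A *\<^sub>v (B *\<^sub>v x)"
    using of_int_hom.mult_mat_vec_hom [OF adj(1) z(1), where ?'a = real] z(2) by simp
  also have "\<dots> = (?A * B) *\<^sub>v x"
    using adj(1) carrier_B x by (intro assoc_mult_mat_vec [symmetric]) auto
  also have "?A * B = map_mat real_of_int (det M \<cdot>\<^sub>m 1\<^sub>m n)"
    unfolding M adj(3) [symmetric] by (rule of_int_hom.mat_hom_mult [OF adj(1) Mc, symmetric])
  finally have eq: "real_vec (adj_mat M *\<^sub>v z) = map_mat real_of_int (det M \<cdot>\<^sub>m 1\<^sub>m n) *\<^sub>v x" .
  have "x $ i \<in> \<rat>" if i: "i < n" for i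
  proof -
    have "(map_mat real_of_int (det M \<cdot>\<^sub>m 1\<^sub>m n) *\<^sub>v x) $ i =
        (\<Sum>j<n. map_mat real_of_int (det M \<cdot>\<^sub>m 1\<^sub>m n) $$ (i, j) * x $ j)"
      using i x by (intro mat_mult_vec_index) auto
    also have "\<dots> = (\<Sum>j<n. if j = i then of_int (det M) * x $ i else 0)"
      using i by (intro sum.cong) auto
    finally have "of_int ((adj_mat M *\<^sub>v z) $ i) = of_int (det M) * x $ i"
      using i adj(1) arg_cong [OF eq, of "\<lambda>y. y $ i"] by simp
    then have "x $ i = of_int ((adj_mat M *\<^sub>v z) $ i) / of_int (det M)"
      using det by (simp add: field_simps)
    then show ?thesis
      by simp
  qed
  then show ?thesis
    using x by (simp add: rational_vec_def)
qed

section \<open>Counting series\<close>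

text \<open>\<open>card\<close> is 0 on infinite sets, so the coefficients count elements only if
  the fibres of \<open>h\<close> are finite.\<close>

definition count_series :: "('a \<Rightarrow> nat) \<Rightarrow> 'a set \<Rightarrow> rat fps" where
  "count_series h A = Abs_fps (\<lambda>k. of_nat (card {x \<in> A. h x = k}))"

text \<open>Convergence in the topology of power series means that each coefficient is eventually
  constant. Coefficient \<open>k\<close> is final as soon as the finite partial sum covers the fibre
  of \<open>h\<close> over \<open>k\<close>.\<close>

lemma has_sum_count_series:
  assumes fin: "\<And>k. finite {x \<in> A. h x = k}"
  shows "((\<lambda>x. fps_X ^ h x) has_sum count_series h A) A"
  unfolding has_sum_def
proof (rule tendsto_fpsI)
  fix k
  have "fps_nth (\<Sum>x\<in>Y. fps_X ^ h x) k = fps_nth (count_series h A) k"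
    if Y: "finite Y" "{x \<in> A. h x = k} \<subseteq> Y" "Y \<subseteq> A" for Y
  proof -
    have "fps_nth (\<Sum>x\<in>Y. fps_X ^ h x) k = (\<Sum>x\<in>Y. if h x = k then 1 else 0 :: rat)"
      unfolding fps_sum_nth by (intro sum.cong) (auto simp: fps_X_power_nth)
    also have "\<dots> = of_nat (card {x \<in> Y. h x = k})"
      using Y(1) by (simp add: sum.If_cases Int_def)
    also have "{x \<in> Y. h x = k} = {x \<in> A. h x = k}"
      using Y by blast
    finally show ?thesis
      by (simp add: count_series_def)
  qed
  then show "eventually (\<lambda>Y. fps_nth (\<Sum>x\<in>Y. fps_X ^ h x) k = fps_nth (count_series h A) k)
      (finite_subsets_at_top A)"
    unfolding eventually_finite_subsets_at_top using fin [of k]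
    by (intro exI [of _ "{x \<in> A. h x = k}"]) auto
qed

lemma count_series_finite:
  assumes "finite A"
  shows "count_series h A = (\<Sum>x\<in>A. fps_X ^ h x)"
proof -
  have "((\<lambda>x. fps_X ^ h x :: rat fps) has_sum count_series h A) A"
    using assms by (intro has_sum_count_series) auto
  then show ?thesis
    using infsumI [of "\<lambda>x. fps_X ^ h x :: rat fps"] assms by (metis infsum_finite)
qed

text \<open>The set \<open>A\<close> is the disjoint union of \<open>f\<close>
  A\<open>and its complement, and the series of\<close>f \<open>A\<close> is that of
  \<open>A\<close> times \<open>fps_X ^ l\<close>.\<close>

lemma count_series_shift:
  assumes fin: "\<And>k. finite {x \<in> A. h x = k}"
    and f: "inj_on f A" "f ` A \<subseteq> A" and h: "\<And>x. x \<in> A \<Longrightarrow> h (f x) = h x + l"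
  shows "count_series h A * (1 - fps_X ^ l) = count_series h (A - f ` A)"
proof (rule fps_ext)
  fix k
  \<comment> \<open>The elements whose shifts have weight \<open>k\<close>. The case distinction
    guards against truncated subtraction when \<open>k < l\<close>.\<close>
  define C where "C = (if k < l then {} else {x \<in> A. h x = k - l})"
  have eq: "{x \<in> A. h x = k} = {x \<in> A - f ` A. h x = k} \<union> f ` C"
  proof (intro Set.equalityI subsetI)
    fix x assume x: "x \<in> {x \<in> A. h x = k}"
    show "x \<in> {x \<in> A - f ` A. h x = k} \<union> f ` C"
    proof (cases "x \<in> f ` A")
      case True
      then obtain y where y: "y \<in> A" "x = f y"
        by blast
      then have "k = h y + l"
        using x h [OF y(1)] by simp
      then have "y \<in> C"
        using y(1) by (simp add: C_def)
      then show ?thesis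
        using y(2) by blast
    qed (use x in blast)
  next
    fix x assume "x \<in> {x \<in> A - f ` A. h x = k} \<union> f ` C"
    then show "x \<in> {x \<in> A. h x = k}"
    proof
      assume "x \<in> f ` C"
      then obtain y where y: "y \<in> A" "\<not> k < l" "h y = k - l" "x = f y"
        by (auto simp: C_def split: if_splits)
      then show ?thesis
        using f(2) h [OF y(1)] by auto
    qed blast
  qed
  have "finite C"
    using fin by (simp add: C_def)
  moreover have "finite {x \<in> A - f ` A. h x = k}"
    by (rule finite_subset [OF _ fin [of k]]) auto
  moreover have "C \<subseteq> A"
    by (auto simp: C_def)
  ultimately have "card {x \<in> A. h x = k} = card {x \<in> A - f ` A. h x = k} + card (f ` C)"
    unfolding eq by (intro card_Un_disjoint) auto
  also have "card (f ` C) = card C"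
    using f(1) by (intro card_image) (auto simp: C_def intro: inj_on_subset)
  finally have "rat_of_nat (card {x \<in> A. h x = k}) = of_nat (card {x \<in> A - f ` A. h x = k}) + of_nat (card C)"
    by simp
  then show "fps_nth (count_series h A * (1 - fps_X ^ l)) k = fps_nth (count_series h (A - f ` A)) k"
    by (simp add: right_diff_distrib fps_X_power_mult_right_nth count_series_def C_def)
qed

lemma div_degree_eq: "D \<in> carrier_vec n \<Longrightarrow> div_degree D = (\<Sum>i<n. D $ i)"
  by (auto simp: div_degree_def)

lemma div_degree_add:
  "D \<in> carrier_vec n \<Longrightarrow> D' \<in> carrier_vec n \<Longrightarrow> div_degree (D + D') = div_degree D + div_degree D'"
  by (auto simp: div_degree_def sum.distrib)

lemma div_degree_smult_unit:
  assumes "v < n"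
  shows "div_degree (c \<cdot>\<^sub>v unit_vec n v) = c"
proof -
  have "div_degree (c \<cdot>\<^sub>v unit_vec n v) = (\<Sum>i<n. if i = v then c else 0)"
    unfolding div_degree_def using assms by (intro sum.cong) auto
  then show ?thesis
    using assms by simp
qed

text \<open>Vertices are treated one at a time by \<open>count_series_shift\<close>. Both directions
  of \<open>shift\<close> matter: one keeps the shifted divisors inside the set, the other shows
  that a divisor with a large coefficient is itself a shift.\<close>

lemma count_series_box:
  assumes A: "A \<subseteq> carrier_vec n" "\<And>F v. F \<in> A \<Longrightarrow> v < n \<Longrightarrow> 0 \<le> F $ v"
    and shift: "\<And>F v. F \<in> carrier_vec n \<Longrightarrow> (\<And>i. i < n \<Longrightarrow> 0 \<le> F $ i) \<Longrightarrow> v < n \<Longrightarrow>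
      F + int (l v) \<cdot>\<^sub>v unit_vec n v \<in> A \<longleftrightarrow> F \<in> A"
    and fin: "\<And>k. finite {F \<in> A. nat (div_degree F) = k}"
    and "m \<le> n"
  shows "count_series (\<lambda>F. nat (div_degree F)) A * (\<Prod>v<m. 1 - fps_X ^ l v) =
    count_series (\<lambda>F. nat (div_degree F)) {F \<in> A. \<forall>v<m. F $ v < int (l v)}"
  using \<open>m \<le> n\<close>
proof (induction m)
  case 0
  then show ?case by simp
next
  case (Suc m)
  let ?h = "\<lambda>F. nat (div_degree F)"
  let ?A = "{F \<in> A. \<forall>v<m. F $ v < int (l v)}"
  let ?f = "\<lambda>F. F + int (l m) \<cdot>\<^sub>v unit_vec n m"
  have m: "m < n"
    using Suc.prems by simp
  have coord: "?f F $ i = F $ i + (if i = m then int (l m) else 0)" if "F \<in> carrier_vec n" "i < n" for F i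
    using that m by simp
  have f_A: "?f F \<in> ?A" if F: "F \<in> ?A" for F
  proof -
    have "F \<in> carrier_vec n"
      using F A(1) by blast
    moreover from this have "?f F \<in> A"
      using shift [of F m] F A(2) m by blast
    ultimately show ?thesis
      using F m by (auto simp: coord simp del: index_add_vec)
  qed
  have diff: "?A - ?f ` ?A = {F \<in> A. \<forall>v<Suc m. F $ v < int (l v)}"
  proof (intro Set.equalityI subsetI)
    fix F assume F: "F \<in> ?A - ?f ` ?A"
    then have FA: "F \<in> A" "F \<in> carrier_vec n"
      using A by auto
    have "F $ m < int (l m)"
    proof (rule ccontr)
      assume ge: "\<not> F $ m < int (l m)"
      \<comment> \<open>The only possible preimage of \<open>F\<close> under the shift; it stays
        effective because \<open>F $ m\<close> is at least \<open>l m\<close>.\<close>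
      let ?G = "F - int (l m) \<cdot>\<^sub>v unit_vec n m"
      have G: "?G \<in> carrier_vec n" "?f ?G = F"
        using FA by (auto intro!: eq_vecI)
      have idx: "?G $ i = F $ i - (if i = m then int (l m) else 0)" if "i < n" for i
        using that m FA by simp
      have "0 \<le> ?G $ i" if "i < n" for i
        unfolding idx [OF that] using ge A(2) [OF FA(1) that] by auto
      then have "?G \<in> A"
        using shift [OF G(1) _ m] G(2) FA(1) by simp
      moreover have "?G $ v < int (l v)" if "v < m" for v
      proof -
        have "?G $ v = F $ v"
          using idx [of v] that m by simp
        then show ?thesis
          using F that by simp
      qed
      ultimately have "?G \<in> ?A"
        by blast
      then have "F \<in> ?f ` ?A"
        by (rule image_eqI [where f = ?f, OF G(2) [symmetric]])
      then show False
        using F by blast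
    qed
    then show "F \<in> {F \<in> A. \<forall>v<Suc m. F $ v < int (l v)}"
      using F by (auto simp: less_Suc_eq)
  next
    fix F assume F: "F \<in> {F \<in> A. \<forall>v<Suc m. F $ v < int (l v)}"
    have "F \<notin> ?f ` ?A"
    proof
      assume "F \<in> ?f ` ?A"
      then obtain G where G: "F = ?f G" "G \<in> A"
        by blast
      then have "F $ m = G $ m + int (l m)"
        using coord [of G m] A(1) m by auto
      then show False
        using A(2) [OF G(2) m] F by auto
    qed
    then show "F \<in> ?A - ?f ` ?A"
      using F by auto
  qed
  have "count_series ?h ?A * (1 - fps_X ^ l m) = count_series ?h (?A - ?f ` ?A)"
  proof (rule count_series_shift)
    show "finite {F \<in> ?A. ?h F = k}" for k
      by (rule finite_subset [OF _ fin [of k]]) auto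
    show "inj_on ?f ?A"
    proof (rule inj_onI)
      fix F G assume FG: "F \<in> ?A" "G \<in> ?A" "?f F = ?f G"
      then have c: "F \<in> carrier_vec n" "G \<in> carrier_vec n"
        using A by auto
      show "F = G"
      proof (rule eq_vecI)
        fix i assume "i < dim_vec G"
        then have "i < n"
          using c by simp
        then show "F $ i = G $ i"
          using arg_cong [OF FG(3), of "\<lambda>x. x $ i"] coord [OF c(1)] coord [OF c(2)] by simp
      qed (use c in simp)
    qed
    show "?f ` ?A \<subseteq> ?A"
      using f_A by blast
    show "?h (?f F) = ?h F + l m" if "F \<in> ?A" for F
    proof -
      have F: "F \<in> carrier_vec n" "\<And>i. i < n \<Longrightarrow> 0 \<le> F $ i"
        using that A by auto
      have "div_degree (?f F) = div_degree F + int (l m)"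
        using F(1) m by (simp add: div_degree_add [of _ n] div_degree_smult_unit)
      moreover have "0 \<le> div_degree F"
        unfolding div_degree_eq [OF F(1)] using F(2) by (intro sum_nonneg) auto
      ultimately show ?thesis
        by (simp add: nat_add_distrib)
    qed
  qed
  then show ?case
    using Suc by (simp add: diff mult.assoc [symmetric])
qed

section \<open>Divisor classes and integer points\<close>

text \<open>In the integral instances of the generic results the simplifier turns
  \<open>of_int\<close> into \<open>id\<close>; this rule then removes the coercion.\<close>

lemma map_mat_id [simp]: "map_mat id A = A"
  by (rule eq_matI) auto

lemma real_vec_inj: "real_vec x = real_vec y \<Longrightarrow> x = y"
  by (rule of_int_hom.vec_hom_inj)

lemma comm_group_degree_zero_group: "comm_group (degree_zero_group n)"
proof (rule comm_groupI)
  fix x assume x: "x \<in> carrier (degree_zero_group n)"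
  then have "- x \<in> carrier (degree_zero_group n)"
    by (auto simp: degree_zero_group_def divisors_def div_degree_def sum_negf)
  moreover have "- x + x = 0\<^sub>v n"
    using x by (auto simp: degree_zero_group_def divisors_def)
  ultimately show "\<exists>y\<in>carrier (degree_zero_group n). y \<otimes>\<^bsub>degree_zero_group n\<^esub> x = \<one>\<^bsub>degree_zero_group n\<^esub>"
    by (intro bexI [of _ "- x"]) (auto simp: degree_zero_group_def)
qed (auto simp: degree_zero_group_def divisors_def comm_add_vec [of _ n]
    div_degree_def sum.distrib)

lemma degree_zero_group_pow:
  fixes k :: nat
  assumes "x \<in> carrier_vec n"
  shows "x [^]\<^bsub>degree_zero_group n\<^esub> k = int k \<cdot>\<^sub>v x"
proof (induction k)
  case 0
  show ?case
    using assms by (auto simp: degree_zero_group_def intro!: eq_vecI)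
next
  case (Suc k)
  have "int k \<cdot>\<^sub>v x + x = int (Suc k) \<cdot>\<^sub>v x"
    using assms by (intro eq_vecI) (auto simp: algebra_simps)
  then show ?case
    using Suc by (simp add: degree_zero_group_def)
qed

text \<open>A coefficient of an effective divisor is at most its degree, so these divisors lie in a
  finite box.\<close>

lemma finite_effective_degree:
  "finite {F \<in> carrier_vec n. (\<forall>i<n. 0 \<le> F $ i) \<and> div_degree F = k}"
proof (rule finite_subset)
  show "finite (vec n ` PiE {..<n} (\<lambda>_. {0..k}))"
    by (intro finite_imageI finite_PiE) auto
  show "{F \<in> carrier_vec n. (\<forall>i<n. 0 \<le> F $ i) \<and> div_degree F = k} \<subseteq> vec n ` PiE {..<n} (\<lambda>_. {0..k})"
  proof
    fix F assume "F \<in> {F \<in> carrier_vec n. (\<forall>i<n. 0 \<le> F $ i) \<and> div_degree F = k}"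
    then have F: "F \<in> carrier_vec n" "\<And>i. i < n \<Longrightarrow> 0 \<le> F $ i" "div_degree F = k"
      by auto
    have "F $ i \<le> k" if "i < n" for i
      unfolding F(3) [symmetric] div_degree_eq [OF F(1)]
      using F(2) that by (intro member_le_sum) auto
    then have "restrict (($) F) {..<n} \<in> PiE {..<n} (\<lambda>_. {0..k})"
      using F(2) by auto
    moreover have "F = vec n (restrict (($) F) {..<n})"
      using F(1) by (intro eq_vecI) auto
    ultimately show "F \<in> vec n ` PiE {..<n} (\<lambda>_. {0..k})"
      by blast
  qed
qed

text \<open>Only the last factor differs from 1. A nonnegative exponent makes \<open>powi\<close> an
  ordinary power, as \<open>fps_X\<close> is not a unit.\<close>

lemma prod_ones_z:
  assumes "0 < n" "0 \<le> \<alpha> $ (n - 1)"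
  shows "(\<Prod>i<n. ones_z n i powi (\<alpha> $ i)) = fps_X ^ nat (\<alpha> $ (n - 1))"
proof -
  have one: "(1 :: rat fps) powi k = 1" for k
    by (simp add: power_int_def fps_inverse_one)
  have "(\<Prod>i<n. ones_z n i powi (\<alpha> $ i)) =
      (\<Prod>i<n. if i = n - 1 then fps_X ^ nat (\<alpha> $ (n - 1)) else 1)"
    using assms by (intro prod.cong) (auto simp: ones_z_def one power_int_def)
  then show ?thesis
    using assms by simp
qed

section \<open>Integer points of the cone and effective divisors\<close>

locale conn_multigraph =
  fixes n :: nat and E :: "nat set multiset"
  assumes conn: "connected_multigraph n E"
begin

lemma mg: "multigraph n E" and n_pos: "0 < n"
  using conn by (auto simp: connected_multigraph_def)

abbreviation "M \<equiv> cone_mat n E"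

sublocale nonsingular n "map_mat real_of_int M"
  using cone_mat_kernel [OF conn] by unfold_locales auto

lemma mult_M_real: "x \<in> carrier_vec n \<Longrightarrow> map_mat real_of_int M *\<^sub>v real_vec x = real_vec (M *\<^sub>v x)"
  by (rule of_int_hom.mult_mat_vec_hom [symmetric]) auto

lemma mult_M_carrier [simp]: "M *\<^sub>v x \<in> carrier_vec n" "dim_vec (M *\<^sub>v x) = n"
  by (auto intro: carrier_vecI)

lemma mult_M_inj:
  assumes "x \<in> carrier_vec n" "y \<in> carrier_vec n" "M *\<^sub>v x = M *\<^sub>v y"
  shows "x = y"
proof -
  have "real_vec x = real_vec y"
    using assms by (intro mult_B_inj) (auto simp: mult_M_real)
  then show ?thesis
    by (rule real_vec_inj)
qed

lemma mult_M_snoc: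
  assumes "f \<in> carrier_vec (n - 1)"
  shows "M *\<^sub>v snoc_vec f t = laplacian n E *\<^sub>v snoc_vec f 0 + t \<cdot>\<^sub>v unit_vec n (n - 1)"
  using cone_mat_mult_snoc [OF n_pos assms, of E t] by simp

lemma div_degree_mult_M:
  assumes "x \<in> carrier_vec n"
  shows "div_degree (M *\<^sub>v x) = x $ (n - 1)"
  using sum_cone_mat_mult_vec [OF mg n_pos assms] by (simp add: div_degree_eq [of _ n])

lemma psi_eq:
  assumes "D \<in> carrier_vec n" "x \<in> carrier_vec n"
  shows "psi n E D x = D + M *\<^sub>v x"
proof -
  have "M *\<^sub>v x = laplacian n E *\<^sub>v snoc_vec (vec_first x (n - 1)) 0 + x $ (n - 1) \<cdot>\<^sub>v unit_vec n (n - 1)"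
    using mult_M_snoc [OF vec_first_carrier, of x "x $ (n - 1)"] snoc_vec_first [OF n_pos assms(2)] by simp
  then show ?thesis
    using assms(1) unfolding psi_def q_divisor_def vertex_divisor_def by (intro eq_vecI) auto
qed

lemma psi_zero: "x \<in> carrier_vec n \<Longrightarrow> psi n E (0\<^sub>v n) x = M *\<^sub>v x"
  by (simp add: psi_eq)

lemma psi_inj:
  assumes D: "D \<in> carrier_vec n"
  shows "inj_on (psi n E D) (carrier_vec n)"
proof (rule inj_onI)
  fix x y assume xy: "x \<in> carrier_vec n" "y \<in> carrier_vec n" "psi n E D x = psi n E D y"
  have "M *\<^sub>v x = M *\<^sub>v y"
  proof (rule eq_vecI)
    fix i assume "i < dim_vec (M *\<^sub>v y)"
    then show "(M *\<^sub>v x) $ i = (M *\<^sub>v y) $ i"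
      using arg_cong [OF xy(3), of "\<lambda>z. z $ i"] psi_eq [OF D xy(1)] psi_eq [OF D xy(2)] by simp
  qed simp
  then show "x = y"
    using mult_M_inj xy by blast
qed

lemma cone_K_eq:
  assumes D: "D \<in> carrier_vec n"
  shows "cone_K n E D = orthant_preimage n (map_mat real_of_int M) (- real_vec D)"
proof -
  have unit: "real_vec (q_divisor n) = unit_vec n (n - 1)"
    unfolding q_divisor_def vertex_divisor_def by (intro eq_vecI) auto
  have iff: "- real_vec D \<le> map_mat real_of_int (laplacian n E) *\<^sub>v snoc_vec f 0 + t \<cdot>\<^sub>v real_vec (q_divisor n)
      \<longleftrightarrow> snoc_vec f t \<in> orthant_preimage n (map_mat real_of_int M) (- real_vec D)"
    if f: "f \<in> carrier_vec (n - 1)" for f t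
    unfolding unit cone_mat_mult_snoc [OF n_pos f, of E t, symmetric] orthant_preimage_def less_eq_vec_def
    using D f n_pos by simp
  show ?thesis
  proof (intro Set.equalityI subsetI)
    fix x assume "x \<in> cone_K n E D"
    then show "x \<in> orthant_preimage n (map_mat real_of_int M) (- real_vec D)"
      unfolding cone_K_def using iff by blast
  next
    fix x assume x: "x \<in> orthant_preimage n (map_mat real_of_int M) (- real_vec D)"
    then have "x = snoc_vec (vec_first x (n - 1)) (x $ (n - 1))"
      using snoc_vec_first [OF n_pos, of x] by (simp add: orthant_preimage_def)
    then show "x \<in> cone_K n E D"
      unfolding cone_K_def using iff [OF vec_first_carrier, of x "x $ (n - 1)"] x vec_first_carrier by (metis (mono_tags, lifting) mem_Collect_eq)
  qed
qed

lemma mult_M_real_index: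
  "x \<in> carrier_vec n \<Longrightarrow> i < n \<Longrightarrow> (map_mat real_of_int M *\<^sub>v real_vec x) $ i = real_of_int ((M *\<^sub>v x) $ i)"
  by (simp add: mult_M_real)

text \<open>For integral \<open>x\<close> the inequality that defines the cone says that the divisor
  \<open>D + M *\<^sub>v x\<close> is effective.\<close>

lemma integer_points_cone_K:
  assumes D: "D \<in> carrier_vec n"
  shows "integer_points (cone_K n E D) = {x \<in> carrier_vec n. \<forall>i<n. 0 \<le> psi n E D x $ i}"
proof -
  have "- real_of_int (D $ i) \<le> real_of_int ((M *\<^sub>v x) $ i) \<longleftrightarrow> 0 \<le> D $ i + (M *\<^sub>v x) $ i" for i x
    by linarith
  then show ?thesis
    unfolding integer_points_def cone_K_eq [OF D] orthant_preimage_def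
    using D by (auto simp: psi_eq mult_M_real_index)
qed

text \<open>Subtracting the constant \<open>g $ (n - 1)\<close> from \<open>g\<close> does not
  change its image under the Laplacian and makes the entry at \<open>q\<close> vanish.\<close>

lemma laplacian_image_eq:
  "laplacian_image n E = {laplacian n E *\<^sub>v snoc_vec f 0 | f. f \<in> carrier_vec (n - 1)}"
proof (intro Set.equalityI subsetI)
  fix F assume "F \<in> laplacian_image n E"
  then obtain g where g: "g \<in> carrier_vec n" "F = laplacian n E *\<^sub>v g"
    by (auto simp: laplacian_image_def)
  define f where "f = vec (n - 1) (\<lambda>i. g $ i - g $ (n - 1))"
  have f: "f \<in> carrier_vec (n - 1)"
    by (simp add: f_def)
  have s: "snoc_vec f 0 \<in> carrier_vec n"
    using f n_pos by simp
  have s_idx: "snoc_vec f 0 $ i = g $ i - g $ (n - 1)" if "i < n" for i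
    using that f n_pos by (cases "i = n - 1") (auto simp: snoc_vec_index [of n] f_def)
  have "laplacian n E *\<^sub>v g = laplacian n E *\<^sub>v snoc_vec f 0"
  proof (rule eq_vecI)
    fix i assume "i < dim_vec (laplacian n E *\<^sub>v snoc_vec f 0)"
    then have i: "i < n" by simp
    show "(laplacian n E *\<^sub>v g) $ i = (laplacian n E *\<^sub>v snoc_vec f 0) $ i"
      using laplacian_mult_vec_index [OF mg i g(1)] laplacian_mult_vec_index [OF mg i s] i
      by (simp add: s_idx)
  qed simp
  then show "F \<in> {laplacian n E *\<^sub>v snoc_vec f 0 | f. f \<in> carrier_vec (n - 1)}"
    using f g(2) by blast
next
  fix F assume "F \<in> {laplacian n E *\<^sub>v snoc_vec f 0 | f. f \<in> carrier_vec (n - 1)}"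
  then show "F \<in> laplacian_image n E"
    using n_pos by (auto simp: laplacian_image_def)
qed

text \<open>Membership in the image of the Laplacian becomes integral solvability of
  \<open>F = M *\<^sub>v x\<close> with prescribed last entry. It is applied to \<open>F - D\<close>
  for the linear systems and to multiples of a vertex for the orders.\<close>

lemma laplacian_image_iff_mult_M:
  assumes F: "F \<in> carrier_vec n"
  shows "F - k \<cdot>\<^sub>v unit_vec n (n - 1) \<in> laplacian_image n E \<longleftrightarrow>
    (\<exists>x\<in>carrier_vec n. x $ (n - 1) = k \<and> F = M *\<^sub>v x)"
proof
  assume "F - k \<cdot>\<^sub>v unit_vec n (n - 1) \<in> laplacian_image n E"
  then obtain f where f: "f \<in> carrier_vec (n - 1)"
    "F - k \<cdot>\<^sub>v unit_vec n (n - 1) = laplacian n E *\<^sub>v snoc_vec f 0"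
    by (auto simp: laplacian_image_eq)
  have "F = M *\<^sub>v snoc_vec f k"
    unfolding mult_M_snoc [OF f(1)] f(2) [symmetric] using F by (intro eq_vecI) auto
  then show "\<exists>x\<in>carrier_vec n. x $ (n - 1) = k \<and> F = M *\<^sub>v x"
    using f(1) n_pos by (intro bexI [of _ "snoc_vec f k"]) (auto simp: snoc_vec_index [of n])
next
  assume "\<exists>x\<in>carrier_vec n. x $ (n - 1) = k \<and> F = M *\<^sub>v x"
  then obtain x where x: "x \<in> carrier_vec n" "x $ (n - 1) = k" "F = M *\<^sub>v x"
    by blast
  let ?f = "vec_first x (n - 1)"
  have "F = laplacian n E *\<^sub>v snoc_vec ?f 0 + k \<cdot>\<^sub>v unit_vec n (n - 1)"
    using mult_M_snoc [OF vec_first_carrier, of x k] snoc_vec_first [OF n_pos x(1)] x by simp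
  then have "F - k \<cdot>\<^sub>v unit_vec n (n - 1) = laplacian n E *\<^sub>v snoc_vec ?f 0"
    by (intro eq_vecI) auto
  then show "F - k \<cdot>\<^sub>v unit_vec n (n - 1) \<in> laplacian_image n E"
    unfolding laplacian_image_eq using vec_first_carrier by blast
qed

lemma linear_system_eq_psi:
  assumes D: "D \<in> carrier_vec n"
  shows "linear_system n E (D + int k \<cdot>\<^sub>v q_divisor n) =
    {F. (\<forall>i<n. 0 \<le> F $ i) \<and> (\<exists>x\<in>carrier_vec n. x $ (n - 1) = int k \<and> F = psi n E D x)}"
proof -
  have iff: "lin_equiv n E F (D + int k \<cdot>\<^sub>v q_divisor n) \<longleftrightarrow>
      (\<exists>x\<in>carrier_vec n. x $ (n - 1) = int k \<and> F = psi n E D x)" if F: "F \<in> carrier_vec n" for F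
  proof -
    have "F - (D + int k \<cdot>\<^sub>v q_divisor n) = (F - D) - int k \<cdot>\<^sub>v unit_vec n (n - 1)"
      using F D unfolding q_divisor_def vertex_divisor_def by (intro eq_vecI) auto
    moreover have "F - D = M *\<^sub>v x \<longleftrightarrow> F = D + M *\<^sub>v x" for x
      using F D by (auto simp: vec_eq_iff)
    ultimately show ?thesis
      unfolding lin_equiv_def using laplacian_image_iff_mult_M [of "F - D" "int k"] F D
      by (simp add: psi_eq cong: bex_cong)
  qed
  have nonneg: "0\<^sub>v n \<le> F \<longleftrightarrow> (\<forall>i<n. 0 \<le> F $ i)" if "F \<in> carrier_vec n" for F :: "int vec"
    using that by (auto simp: less_eq_vec_def)
  have car: "psi n E D x \<in> carrier_vec n" if "x \<in> carrier_vec n" for x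
    using D that by (simp add: psi_eq)
  show ?thesis
  proof (intro Set.equalityI subsetI)
    fix F assume "F \<in> linear_system n E (D + int k \<cdot>\<^sub>v q_divisor n)"
    then have "F \<in> carrier_vec n" "0\<^sub>v n \<le> F" "lin_equiv n E F (D + int k \<cdot>\<^sub>v q_divisor n)"
      by (auto simp: linear_system_def divisors_def)
    then show "F \<in> {F. (\<forall>i<n. 0 \<le> F $ i) \<and>
        (\<exists>x\<in>carrier_vec n. x $ (n - 1) = int k \<and> F = psi n E D x)}"
      using nonneg iff by blast
  next
    fix F assume F: "F \<in> {F. (\<forall>i<n. 0 \<le> F $ i) \<and>
        (\<exists>x\<in>carrier_vec n. x $ (n - 1) = int k \<and> F = psi n E D x)}"
    then have "F \<in> carrier_vec n"
      using car by blast
    then show "F \<in> linear_system n E (D + int k \<cdot>\<^sub>v q_divisor n)"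
      unfolding linear_system_def divisors_def using F nonneg iff by blast
  qed
qed

lemma div_degree_psi:
  assumes "D \<in> carrier_vec n" "div_degree D = 0" "x \<in> carrier_vec n"
  shows "div_degree (psi n E D x) = x $ (n - 1)"
  using assms by (simp add: psi_eq div_degree_add [of _ n] div_degree_mult_M)

text \<open>The union over \<open>k\<close> runs over natural numbers only. This suffices, because
  the last entry of an integer point of the cone is the degree of an effective divisor.\<close>

lemma effective_class_eq:
  assumes D: "D \<in> carrier_vec n" "div_degree D = 0"
  shows "effective_class n E D = psi n E D ` integer_points (cone_K n E D)"
proof -
  have "\<exists>k. x $ (n - 1) = int k" if x: "x \<in> carrier_vec n" "\<forall>i<n. 0 \<le> psi n E D x $ i" for x
  proof -
    have "psi n E D x \<in> carrier_vec n"
      using D x by (simp add: psi_eq)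
    then have "0 \<le> div_degree (psi n E D x)"
      using x(2) by (auto simp: div_degree_eq intro!: sum_nonneg)
    then show ?thesis
      using div_degree_psi [OF D x(1)] nonneg_int_cases by metis
  qed
  then show ?thesis
    unfolding effective_class_def linear_system_eq_psi [OF D(1)] integer_points_cone_K [OF D(1)] by blast
qed

lemma effective_class_carrier:
  assumes D: "D \<in> carrier_vec n" "div_degree D = 0" and "F \<in> effective_class n E D"
  shows "F \<in> carrier_vec n" "\<And>i. i < n \<Longrightarrow> 0 \<le> F $ i" "0 \<le> div_degree F"
proof -
  show c: "F \<in> carrier_vec n" and "\<And>i. i < n \<Longrightarrow> 0 \<le> F $ i"
    using assms(3) D by (auto simp: effective_class_eq integer_points_cone_K psi_eq)
  then show "0 \<le> div_degree F"
    by (auto simp: div_degree_eq intro!: sum_nonneg)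
qed

text \<open>As \<open>D\<close> has degree 0, the degree of a divisor in the class reveals the
  \<open>k\<close> it belongs to, so the linear systems are the graded pieces.\<close>

lemma linear_system_eq:
  assumes D: "D \<in> carrier_vec n" "div_degree D = 0"
  shows "linear_system n E (D + int k \<cdot>\<^sub>v q_divisor n) =
    {F \<in> effective_class n E D. nat (div_degree F) = k}"
proof (intro Set.equalityI subsetI)
  fix F assume F: "F \<in> linear_system n E (D + int k \<cdot>\<^sub>v q_divisor n)"
  then have "F \<in> effective_class n E D"
    unfolding effective_class_def by blast
  then show "F \<in> {F \<in> effective_class n E D. nat (div_degree F) = k}"
    using F div_degree_psi [OF D] unfolding linear_system_eq_psi [OF D(1)] by auto
next
  fix F assume F: "F \<in> {F \<in> effective_class n E D. nat (div_degree F) = k}"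
  then obtain x where x: "x \<in> carrier_vec n" "\<forall>i<n. 0 \<le> psi n E D x $ i" "F = psi n E D x"
    using D by (auto simp: effective_class_eq integer_points_cone_K)
  have "x $ (n - 1) = int k"
    using F effective_class_carrier(3) [OF D, of F] div_degree_psi [OF D x(1)] x(3) by auto
  then show "F \<in> linear_system n E (D + int k \<cdot>\<^sub>v q_divisor n)"
    unfolding linear_system_eq_psi [OF D(1)] using x by blast
qed

lemma finite_effective_class_fiber:
  assumes D: "D \<in> carrier_vec n" "div_degree D = 0"
  shows "finite {F \<in> effective_class n E D. nat (div_degree F) = k}"
proof (rule finite_subset [OF _ finite_effective_degree [of n "int k"]], rule subsetI)
  fix F assume "F \<in> {F \<in> effective_class n E D. nat (div_degree F) = k}"
  then show "F \<in> {F \<in> carrier_vec n. (\<forall>i<n. 0 \<le> F $ i) \<and> div_degree F = int k}"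
    using effective_class_carrier [OF D, of F] by auto
qed

lemma Lambda_series_eq:
  assumes D: "D \<in> carrier_vec n" "div_degree D = 0"
  shows "Lambda_series n E D = count_series (\<lambda>F. nat (div_degree F)) (effective_class n E D)"
  unfolding Lambda_series_def count_series_def linear_system_eq [OF D] ..

text \<open>At \<open>(1, \<dots>, 1, z)\<close> the monomial of \<open>x\<close> is
  \<open>z\<close> to the degree of its image, and \<open>psi\<close> is injective, so the sum can
  be reindexed. The set \<open>S\<close> will be the cone and the parallelepiped.\<close>

lemma transform_eq_count_series:
  assumes D: "D \<in> carrier_vec n" "div_degree D = 0"
    and S: "integer_points S \<subseteq> integer_points (cone_K n E D)"
  shows "integer_point_transform n S (ones_z n) =
    count_series (\<lambda>F. nat (div_degree F)) (psi n E D ` integer_points S)"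
proof -
  have x: "x \<in> carrier_vec n" "psi n E D x \<in> effective_class n E D" if "x \<in> integer_points S" for x
    using that S D by (auto simp: integer_points_cone_K effective_class_eq)
  have "integer_point_transform n S (ones_z n) =
      (\<Sum>\<^sub>\<infinity>x\<in>integer_points S. fps_X ^ nat (div_degree (psi n E D x)))"
    unfolding integer_point_transform_def
  proof (rule infsum_cong)
    fix x assume "x \<in> integer_points S"
    then show "(\<Prod>i<n. ones_z n i powi (x $ i)) = fps_X ^ nat (div_degree (psi n E D x))"
      using x [of x] effective_class_carrier(3) [OF D, of "psi n E D x"] prod_ones_z [OF n_pos]
        div_degree_psi [OF D] by simp
  qed
  also have "\<dots> = (\<Sum>\<^sub>\<infinity>F\<in>psi n E D ` integer_points S. fps_X ^ nat (div_degree F))"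
    using inj_on_subset [OF psi_inj [OF D(1)], of "integer_points S"] x(1)
    by (subst infsum_reindex) (auto simp: o_def)
  also have "\<dots> = count_series (\<lambda>F. nat (div_degree F)) (psi n E D ` integer_points S)"
  proof (intro infsumI has_sum_count_series)
    show "finite {F \<in> psi n E D ` integer_points S. nat (div_degree F) = k}" for k
      using x(2) by (intro finite_subset [OF _ finite_effective_class_fiber [OF D, of k]]) auto
  qed
  finally show ?thesis .
qed

section \<open>Orders in the Jacobian\<close>

lemma laplacian_image_normal: "laplacian_image n E \<lhd> degree_zero_group n"
proof -
  interpret G: comm_group "degree_zero_group n"
    by (rule comm_group_degree_zero_group)
  have car: "laplacian n E *\<^sub>v f \<in> carrier_vec n" for f
    by (auto intro: carrier_vecI)
  have "subgroup (laplacian_image n E) (degree_zero_group n)"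
  proof (rule G.subgroupI)
    show "laplacian_image n E \<subseteq> carrier (degree_zero_group n)"
      using sum_laplacian_mult_vec [OF mg, where ?'a = int] car
      by (auto simp: laplacian_image_def degree_zero_group_def divisors_def div_degree_def)
    show "laplacian_image n E \<noteq> {}"
      using zero_carrier_vec [of n, where ?'a = int] unfolding laplacian_image_def by blast
  next
    fix F assume F: "F \<in> laplacian_image n E"
    then obtain f where f: "f \<in> carrier_vec n" "F = laplacian n E *\<^sub>v f"
      by (auto simp: laplacian_image_def)
    have Fc: "F \<in> carrier_vec n"
      using f car by simp
    have "laplacian n E *\<^sub>v (- f) = - F"
    proof (rule eq_vecI)
      fix i assume "i < dim_vec (- F)"
      then show "(laplacian n E *\<^sub>v - f) $ i = (- F) $ i"
        using f Fc by (simp add: mat_mult_vec_index [of _ n n] sum_negf)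
    qed (use Fc in simp)
    moreover have "F \<in> carrier (degree_zero_group n)" "- F \<in> carrier (degree_zero_group n)"
      using sum_laplacian_mult_vec [OF mg f(1)] f(2) Fc
      by (auto simp: degree_zero_group_def divisors_def div_degree_def sum_negf)
    moreover have "- F \<otimes>\<^bsub>degree_zero_group n\<^esub> F = \<one>\<^bsub>degree_zero_group n\<^esub>"
      using Fc by (simp add: degree_zero_group_def)
    ultimately show "inv\<^bsub>degree_zero_group n\<^esub> F \<in> laplacian_image n E"
      using G.inv_equality [of "- F" F] f(1) by (auto simp: laplacian_image_def intro!: exI [of _ "- f"])
  next
    fix F F' assume "F \<in> laplacian_image n E" "F' \<in> laplacian_image n E"
    then obtain f f' where "f \<in> carrier_vec n" "F = laplacian n E *\<^sub>v f"
        "f' \<in> carrier_vec n" "F' = laplacian n E *\<^sub>v f'"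
      by (auto simp: laplacian_image_def)
    then show "F \<otimes>\<^bsub>degree_zero_group n\<^esub> F' \<in> laplacian_image n E"
      by (auto simp: laplacian_image_def degree_zero_group_def
          mult_add_distrib_mat_vec [of _ n n, symmetric] intro!: exI [of _ "f + f'"])
  qed
  then show ?thesis
    by (simp add: G.normal_iff_subgroup)
qed

text \<open>The order divides \<open>l\<close> iff the \<open>l\<close>-th power of the class of
  \<open>v - q\<close> is trivial, that is, iff \<open>l v - l q\<close> lies in the image of the
  Laplacian.\<close>

lemma ord_q_dvd_iff:
  assumes v: "v < n"
  shows "ord_q n E v dvd l \<longleftrightarrow> (\<exists>x\<in>carrier_vec n. M *\<^sub>v x = int l \<cdot>\<^sub>v unit_vec n v)"
proof -
  let ?G = "degree_zero_group n" and ?H = "laplacian_image n E"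
  let ?a = "vertex_divisor n v - q_divisor n"
  interpret normal ?H ?G
    by (rule laplacian_image_normal)
  interpret J: group "jacobian n E"
    unfolding jacobian_def by (rule factorgroup_is_group)
  have ac: "?a \<in> carrier_vec n"
    by (auto simp: vertex_divisor_def q_divisor_def)
  have "div_degree ?a = (\<Sum>i<n. (if i = v then 1 else 0) - (if i = n - 1 then 1 else 0))"
    unfolding div_degree_eq [OF ac] using v n_pos
    by (intro sum.cong) (auto simp: vertex_divisor_def q_divisor_def)
  then have "div_degree ?a = 0"
    using v n_pos by (simp add: sum_subtractf)
  then have a: "?a \<in> carrier ?G"
    using ac by (simp add: degree_zero_group_def divisors_def)
  have la: "int l \<cdot>\<^sub>v ?a \<in> carrier ?G"
    using nat_pow_closed [OF a, of l] degree_zero_group_pow [OF ac, of l] by simp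
  have "ord_q n E v dvd l \<longleftrightarrow> (?H #>\<^bsub>?G\<^esub> ?a) [^]\<^bsub>jacobian n E\<^esub> l = \<one>\<^bsub>jacobian n E\<^esub>"
    unfolding ord_q_def using a
    by (subst J.pow_eq_id) (auto simp: jacobian_def carrier_FactGroup)
  also have "\<dots> \<longleftrightarrow> ?H #>\<^bsub>?G\<^esub> (int l \<cdot>\<^sub>v ?a) = ?H"
    unfolding jacobian_def using FactGroup_pow [OF a, of l] degree_zero_group_pow [OF ac, of l] by simp
  also have "\<dots> \<longleftrightarrow> int l \<cdot>\<^sub>v ?a \<in> ?H"
    using coset_join1 [OF _ la] coset_join2 [OF la] subgroup_axioms by blast
  also have "int l \<cdot>\<^sub>v ?a = int l \<cdot>\<^sub>v unit_vec n v - int l \<cdot>\<^sub>v unit_vec n (n - 1)"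
    unfolding vertex_divisor_def q_divisor_def by (intro eq_vecI) (auto simp: algebra_simps)
  also have "\<dots> \<in> ?H \<longleftrightarrow> (\<exists>x\<in>carrier_vec n. x $ (n - 1) = int l \<and> int l \<cdot>\<^sub>v unit_vec n v = M *\<^sub>v x)"
    by (rule laplacian_image_iff_mult_M) simp
  \<comment> \<open>The condition on the last entry is automatic: that entry is the degree of the
    image, which is \<open>l\<close>.\<close>
  also have "\<dots> \<longleftrightarrow> (\<exists>x\<in>carrier_vec n. M *\<^sub>v x = int l \<cdot>\<^sub>v unit_vec n v)"
    using div_degree_mult_M div_degree_smult_unit [OF v, of "int l"] by metis
  finally show ?thesis .
qed


section \<open>The apex and rationality of the cone\<close>

lemma nonsingular_reduced_laplacian:
  "nonsingular (n - 1) (map_mat real_of_int (reduced_laplacian n E))"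
  using reduced_laplacian_kernel [OF conn] reduced_laplacian_carrier [of n E] by unfold_locales auto

text \<open>The inverse of the reduced Laplacian settles the first \<open>n - 1\<close> coordinates.
  The last one agrees because both sides have coordinate sum 0, which is where the degree of
  \<open>D\<close> enters.\<close>

lemma cone_apex:
  assumes D: "D \<in> carrier_vec n" "div_degree D = 0"
  shows "cone_apex n E D \<in> carrier_vec n"
    and "map_mat real_of_int M *\<^sub>v cone_apex n E D = - real_vec D"
proof -
  let ?R = "map_mat real_of_int (reduced_laplacian n E)"
  let ?b = "- real_vec (vec_first D (n - 1))"
  interpret R: nonsingular "n - 1" ?R
    by (rule nonsingular_reduced_laplacian)
  \<comment> \<open>A nonzero determinant excludes the answer \<open>None\<close> of
    \<open>mat_inverse\<close>, so \<open>the\<close> in the definition of the apex yields the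
    inverse.\<close>
  have "?R \<in> Units (ring_mat TYPE(real) (n - 1) ())"
    by (rule det_non_zero_imp_unit [OF R.carrier_B R.det_B])
  then obtain C where C: "mat_inverse ?R = Some C"
    using mat_inverse(1) [OF R.carrier_B, of "()"] by (cases "mat_inverse ?R") auto
  then have inv: "?R * C = 1\<^sub>m (n - 1)" and Cc: "C \<in> carrier_mat (n - 1) (n - 1)"
    using mat_inverse(2) [OF R.carrier_B] by auto
  define f where "f = C *\<^sub>v ?b"
  have b: "?b \<in> carrier_vec (n - 1)"
    by simp
  have f: "f \<in> carrier_vec (n - 1)"
    using Cc by (auto simp: f_def intro: carrier_vecI)
  have Rf: "?R *\<^sub>v f = ?b"
    unfolding f_def using assoc_mult_mat_vec [OF R.carrier_B Cc b] inv by simp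
  have apex: "cone_apex n E D = snoc_vec f 0"
    unfolding cone_apex_def C f_def by simp
  then show c: "cone_apex n E D \<in> carrier_vec n"
    using f n_pos by simp
  let ?y = "map_mat real_of_int M *\<^sub>v cone_apex n E D"
  have y: "?y $ i = - real_of_int (D $ i)" if "i < n - 1" for i
  proof -
    have "?y $ i = (map_mat real_of_int (laplacian n E) *\<^sub>v snoc_vec f 0) $ i"
      unfolding apex cone_mat_mult_snoc [OF n_pos f] using that by simp
    also have "\<dots> = ?b $ i"
      using reduced_laplacian_mult_vec [OF n_pos f that, of E] Rf by simp
    also have "\<dots> = - real_of_int (D $ i)"
      using that by (simp add: vec_first_def)
    finally show ?thesis .
  qed
  have split: "{..<n} = insert (n - 1) {..<n - 1}"
    using n_pos by auto
  have "(\<Sum>i<n. ?y $ i) = 0"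
    using sum_cone_mat_mult_vec [OF mg n_pos c] f n_pos by (simp add: apex snoc_vec_index [of n])
  then have "?y $ (n - 1) = (\<Sum>i<n - 1. real_of_int (D $ i))"
    unfolding split by (simp add: y sum_negf)
  also have "\<dots> = - real_of_int (D $ (n - 1))"
    using arg_cong [OF D(2), of real_of_int] unfolding div_degree_eq [OF D(1)] split by simp
  finally have last: "?y $ (n - 1) = - real_of_int (D $ (n - 1))" .
  show "?y = - real_vec D"
  proof (rule eq_vecI)
    fix i assume "i < dim_vec (- real_vec D)"
    then show "?y $ i = (- real_vec D) $ i"
      using y [of i] last D(1) by (cases "i = n - 1") auto
  qed (use D in simp)
qed

text \<open>The preimages of the unit vectors serve as generators; they and the apex have integral
  images, hence are rational. The factor 1 is written out to match the ray lemmas with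
  \<open>m\<close> constantly 1.\<close>

lemma rational_simplicial_cone_K:
  assumes D: "D \<in> carrier_vec n" "div_degree D = 0"
  shows "rational_simplicial_cone n (cone_apex n E D) (cone_K n E D)"
proof -
  have "\<exists>x\<in>carrier_vec n. map_mat real_of_int M *\<^sub>v x = 1 \<cdot>\<^sub>v unit_vec n v" for v
    using mult_B_surj [of "1 \<cdot>\<^sub>v unit_vec n v"] by auto
  then obtain w where w: "\<And>v. w v \<in> carrier_vec n"
      "\<And>v. map_mat real_of_int M *\<^sub>v w v = 1 \<cdot>\<^sub>v unit_vec n v"
    by metis
  have rat: "rational_vec (w v)" for v
  proof (rule rational_vec_if_integral_image [OF refl w(1)])
    show "map_mat real_of_int M *\<^sub>v w v = real_vec (unit_vec n v)"
      unfolding w(2) by (intro eq_vecI) (auto simp: unit_vec_def)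
  qed simp
  have rat_apex: "rational_vec (cone_apex n E D)"
  proof (rule rational_vec_if_integral_image [OF refl cone_apex(1) [OF D]])
    show "map_mat real_of_int M *\<^sub>v cone_apex n E D = real_vec (- D)"
      unfolding cone_apex(2) [OF D] by (intro eq_vecI) auto
  qed (use D in simp)
  have "affine_cone n (cone_apex n E D) (w ` {..<n}) (cone_K n E D)"
    unfolding cone_K_eq [OF D(1)]
    using affine_cone_rays [of w "\<lambda>_. 1", OF w(1) w(2) _ cone_apex [OF D]] by simp
  moreover have "card (w ` {..<n}) = n"
    using card_image [OF rays_inj [of w "\<lambda>_. 1", OF w(1) w(2)]] by simp
  ultimately show ?thesis
    unfolding rational_simplicial_cone_def using rat rat_apex by blast
qed

section \<open>Integral extreme rays and primary divisors\<close>

lemma integral_rays_real: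
  assumes "z \<in> carrier_vec n" "M *\<^sub>v z = int l \<cdot>\<^sub>v unit_vec n v"
  shows "map_mat real_of_int M *\<^sub>v real_vec z = real l \<cdot>\<^sub>v unit_vec n v"
  unfolding mult_M_real [OF assms(1)] assms(2) by (intro eq_vecI) (auto simp: unit_vec_def)

lemma primary_set_inj:
  assumes "\<And>v. v < n \<Longrightarrow> 0 < l v"
  shows "inj_on (\<lambda>v. int (l v) \<cdot>\<^sub>v vertex_divisor n v) {..<n}"
proof (rule inj_onI)
  fix u v assume uv: "u \<in> {..<n}" "v \<in> {..<n}"
    and eq: "int (l u) \<cdot>\<^sub>v vertex_divisor n u = int (l v) \<cdot>\<^sub>v vertex_divisor n v"
  have "int (l u) = int (l v) * (if u = v then 1 else 0)"
    using arg_cong [OF eq, of "\<lambda>x. x $ u"] uv by (simp add: vertex_divisor_def)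
  then show "u = v"
    using assms [of u] uv by (cases "u = v") simp_all
qed

text \<open>Indexes the generators by the vertices. This is possible because \<open>psi\<close> is
  injective and, the multiplicities being positive, distinct vertices give distinct primary
  divisors.\<close>

lemma primary_set_rays:
  assumes \<Omega>: "\<Omega> \<subseteq> carrier_vec n" "psi n E (0\<^sub>v n) ` \<Omega> = primary_set n l"
    and l: "\<And>v. v < n \<Longrightarrow> 0 < l v"
  obtains z where "\<Omega> = z ` {..<n}" "inj_on z {..<n}" "\<And>v. v < n \<Longrightarrow> z v \<in> carrier_vec n"
    "\<And>v. v < n \<Longrightarrow> M *\<^sub>v z v = int (l v) \<cdot>\<^sub>v unit_vec n v"
proof -
  have "\<exists>x\<in>\<Omega>. psi n E (0\<^sub>v n) x = int (l v) \<cdot>\<^sub>v vertex_divisor n v" if "v < n" for v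
  proof -
    have "int (l v) \<cdot>\<^sub>v vertex_divisor n v \<in> psi n E (0\<^sub>v n) ` \<Omega>"
      unfolding \<Omega>(2) primary_set_def using that by blast
    then show ?thesis
      by auto
  qed
  then obtain z where z: "\<And>v. v < n \<Longrightarrow> z v \<in> \<Omega>"
      "\<And>v. v < n \<Longrightarrow> psi n E (0\<^sub>v n) (z v) = int (l v) \<cdot>\<^sub>v vertex_divisor n v"
    by metis
  have inj: "inj_on (psi n E (0\<^sub>v n)) \<Omega>"
    using psi_inj [OF zero_carrier_vec] \<Omega>(1) by (rule inj_on_subset)
  have "\<Omega> \<subseteq> z ` {..<n}"
  proof
    fix x assume x: "x \<in> \<Omega>"
    then have "psi n E (0\<^sub>v n) x \<in> primary_set n l"
      using \<Omega>(2) by blast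
    then obtain v where v: "v < n" "psi n E (0\<^sub>v n) x = int (l v) \<cdot>\<^sub>v vertex_divisor n v"
      by (auto simp: primary_set_def)
    then have "x = z v"
      using inj_onD [OF inj _ x z(1)] z(2) by simp
    then show "x \<in> z ` {..<n}"
      using v by blast
  qed
  moreover have "inj_on z {..<n}"
  proof (rule inj_onI)
    fix u v assume uv: "u \<in> {..<n}" "v \<in> {..<n}" "z u = z v"
    then have "int (l u) \<cdot>\<^sub>v vertex_divisor n u = int (l v) \<cdot>\<^sub>v vertex_divisor n v"
      using z(2) [of u] z(2) [of v] by simp
    then show "u = v"
      using primary_set_inj [of l, OF l] uv(1,2) unfolding inj_on_def by blast
  qed
  moreover have zc: "z v \<in> carrier_vec n" if "v < n" for v
    using z(1) [OF that] \<Omega>(1) by blast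
  moreover have "M *\<^sub>v z v = int (l v) \<cdot>\<^sub>v unit_vec n v" if "v < n" for v
    using z(2) [OF that] psi_zero [OF zc [OF that]] by (simp add: vertex_divisor_def)
  ultimately show ?thesis
    using that [of z] z(1) by blast
qed

lemma integral_extreme_generators_carrier:
  "integral_extreme_generators n K \<Omega> \<Longrightarrow> \<Omega> \<subseteq> carrier_vec n"
  by (auto simp: integral_extreme_generators_def affine_cone_def)

text \<open>The generators are rays over real multiples of the axes. As they are integral, so are
  their images; the multiples are positive integers, and \<open>ord_q_dvd_iff\<close> supplies
  divisibility by the order.\<close>

lemma psi_image_extreme_generators:
  assumes D: "D \<in> carrier_vec n" and gen: "integral_extreme_generators n (cone_K n E D) \<Omega>"
  obtains l where "primary_multiplicities n E l" "psi n E (0\<^sub>v n) ` \<Omega> = primary_set n l"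
proof -
  obtain p where cone: "affine_cone n p (real_vec ` \<Omega>) (orthant_preimage n (map_mat real_of_int M) (- real_vec D))"
    using gen unfolding integral_extreme_generators_def cone_K_eq [OF D] by blast
  have ext: "\<And>\<omega>. \<omega> \<in> real_vec ` \<Omega> \<Longrightarrow> extreme_generator n (real_vec ` \<Omega>) \<omega>"
    using gen unfolding integral_extreme_generators_def by blast
  have "- real_vec D \<in> carrier_vec n"
    using D by simp
  then obtain w m where w: "real_vec ` \<Omega> = w ` {..<n}"
      "\<And>v. v < n \<Longrightarrow> map_mat real_of_int M *\<^sub>v w v = m v \<cdot>\<^sub>v unit_vec n v"
      "\<And>v. v < n \<Longrightarrow> 0 < m v"
    using extreme_generators_are_rays [OF cone _ ext] by blast
  have \<Omega>: "\<Omega> \<subseteq> carrier_vec n"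
    by (rule integral_extreme_generators_carrier [OF gen])
  have "\<exists>x\<in>\<Omega>. w v = real_vec x" if "v < n" for v
    using w(1) that by (metis imageE imageI lessThan_iff)
  then obtain z where z: "\<And>v. v < n \<Longrightarrow> z v \<in> \<Omega>" "\<And>v. v < n \<Longrightarrow> w v = real_vec (z v)"
    by metis
  have zc: "z v \<in> carrier_vec n" if "v < n" for v
    using z(1) [OF that] \<Omega> by blast
  \<comment> \<open>This coordinate equals the positive real \<open>m v\<close>, so
    \<open>nat\<close> loses nothing.\<close>
  define l where "l v = nat ((M *\<^sub>v z v) $ v)" for v
  have coord: "real_of_int ((M *\<^sub>v z v) $ i) = (if i = v then m v else 0)" if "v < n" "i < n" for v i
  proof -
    have "real_of_int ((M *\<^sub>v z v) $ i) = (map_mat real_of_int M *\<^sub>v w v) $ i"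
      using mult_M_real_index [OF zc] that z(2) by simp
    then show ?thesis
      using w(2) that by simp
  qed
  have l: "0 < l v" "M *\<^sub>v z v = int (l v) \<cdot>\<^sub>v unit_vec n v" if v: "v < n" for v
  proof -
    have "0 < real_of_int ((M *\<^sub>v z v) $ v)"
      using coord [OF v v] w(3) [OF v] by simp
    then have pos: "0 < (M *\<^sub>v z v) $ v"
      by simp
    then show "0 < l v"
      by (simp add: l_def)
    show "M *\<^sub>v z v = int (l v) \<cdot>\<^sub>v unit_vec n v"
    proof (rule eq_vecI)
      fix i assume "i < dim_vec (int (l v) \<cdot>\<^sub>v unit_vec n v)"
      then show "(M *\<^sub>v z v) $ i = (int (l v) \<cdot>\<^sub>v unit_vec n v) $ i"
        using coord [OF v, of i] pos v by (cases "i = v") (simp_all add: l_def)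
    qed simp
  qed
  have "\<Omega> = z ` {..<n}"
  proof (intro Set.equalityI subsetI)
    fix x assume "x \<in> \<Omega>"
    then obtain v where "v < n" "real_vec x = w v"
      using w(1) by (metis imageE imageI lessThan_iff)
    then show "x \<in> z ` {..<n}"
      using z(2) [of v] real_vec_inj [of x "z v"] by simp
  qed (use z(1) in auto)
  then have "psi n E (0\<^sub>v n) ` \<Omega> = (\<lambda>v. psi n E (0\<^sub>v n) (z v)) ` {..<n}"
    by (simp only: image_image)
  also have "\<dots> = primary_set n l"
    unfolding primary_set_def
    by (intro image_cong) (auto simp: psi_zero [OF zc] l vertex_divisor_def)
  finally have "psi n E (0\<^sub>v n) ` \<Omega> = primary_set n l" .
  moreover have "primary_multiplicities n E l"
    unfolding primary_multiplicities_def using l ord_q_dvd_iff zc by blast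
  ultimately show ?thesis
    using that by blast
qed

text \<open>Divisibility by the order provides integral preimages of the primary divisors, and these
  are rays of the cone.\<close>

lemma extreme_generators_if_primary:
  assumes D: "D \<in> carrier_vec n" "div_degree D = 0" and l: "primary_multiplicities n E l"
  obtains \<Omega> where "integral_extreme_generators n (cone_K n E D) \<Omega>"
    "psi n E (0\<^sub>v n) ` \<Omega> = primary_set n l"
proof -
  have "\<exists>x\<in>carrier_vec n. M *\<^sub>v x = int (l v) \<cdot>\<^sub>v unit_vec n v" if "v < n" for v
    using l that ord_q_dvd_iff [OF that] unfolding primary_multiplicities_def by blast
  then obtain z where z: "\<And>v. v < n \<Longrightarrow> z v \<in> carrier_vec n"
      "\<And>v. v < n \<Longrightarrow> M *\<^sub>v z v = int (l v) \<cdot>\<^sub>v unit_vec n v"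
    by metis
  let ?w = "\<lambda>v. real_vec (z v)" and ?m = "\<lambda>v. real (l v)"
  have w: "\<And>v. v < n \<Longrightarrow> ?w v \<in> carrier_vec n"
      "\<And>v. v < n \<Longrightarrow> map_mat real_of_int M *\<^sub>v ?w v = ?m v \<cdot>\<^sub>v unit_vec n v"
      "\<And>v. v < n \<Longrightarrow> 0 < ?m v"
    using z integral_rays_real l by (auto simp: primary_multiplicities_def)
  have img: "real_vec ` z ` {..<n} = ?w ` {..<n}"
    by (simp only: image_image)
  have "integral_extreme_generators n (cone_K n E D) (z ` {..<n})"
    unfolding integral_extreme_generators_def img cone_K_eq [OF D(1)]
    using affine_cone_rays [OF w cone_apex [OF D]] extreme_generator_rays [OF w] by blast
  moreover have "psi n E (0\<^sub>v n) ` z ` {..<n} = primary_set n l"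
    unfolding primary_set_def image_image
    by (intro image_cong) (auto simp: psi_zero z vertex_divisor_def)
  ultimately show ?thesis
    using that by blast
qed

lemma bij_betw_generators_primary_sets:
  assumes D: "D \<in> carrier_vec n" "div_degree D = 0"
  shows "bij_betw (\<lambda>\<Omega>. psi n E (0\<^sub>v n) ` \<Omega>)
    {\<Omega>. integral_extreme_generators n (cone_K n E D) \<Omega>}
    {primary_set n l | l. primary_multiplicities n E l}"
  unfolding bij_betw_def
proof (intro conjI Set.equalityI subsetI)
  show "inj_on (\<lambda>\<Omega>. psi n E (0\<^sub>v n) ` \<Omega>) {\<Omega>. integral_extreme_generators n (cone_K n E D) \<Omega>}"
  proof (rule inj_onI)
    fix \<Omega> \<Omega>' assume "\<Omega> \<in> {\<Omega>. integral_extreme_generators n (cone_K n E D) \<Omega>}"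
      "\<Omega>' \<in> {\<Omega>. integral_extreme_generators n (cone_K n E D) \<Omega>}"
      and eq: "psi n E (0\<^sub>v n) ` \<Omega> = psi n E (0\<^sub>v n) ` \<Omega>'"
    then have "\<Omega> \<subseteq> carrier_vec n" "\<Omega>' \<subseteq> carrier_vec n"
      using integral_extreme_generators_carrier by blast+
    then show "\<Omega> = \<Omega>'"
      using inj_on_image_eq_iff [OF psi_inj [OF zero_carrier_vec]] eq by blast
  qed
next
  fix P assume "P \<in> (\<lambda>\<Omega>. psi n E (0\<^sub>v n) ` \<Omega>) ` {\<Omega>. integral_extreme_generators n (cone_K n E D) \<Omega>}"
  then obtain \<Omega> where "integral_extreme_generators n (cone_K n E D) \<Omega>" "P = psi n E (0\<^sub>v n) ` \<Omega>"
    by blast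
  then show "P \<in> {primary_set n l | l. primary_multiplicities n E l}"
    using psi_image_extreme_generators [OF D(1), of \<Omega>] by blast
next
  fix P assume "P \<in> {primary_set n l | l. primary_multiplicities n E l}"
  then obtain l where l: "primary_multiplicities n E l" "P = primary_set n l"
    by blast
  obtain \<Omega> where \<Omega>: "integral_extreme_generators n (cone_K n E D) \<Omega>"
      "psi n E (0\<^sub>v n) ` \<Omega> = primary_set n l"
    by (rule extreme_generators_if_primary [OF D l(1)])
  show "P \<in> (\<lambda>\<Omega>. psi n E (0\<^sub>v n) ` \<Omega>) ` {\<Omega>. integral_extreme_generators n (cone_K n E D) \<Omega>}"
    unfolding l(2) \<Omega>(2) [symmetric] using \<Omega>(1) by (intro imageI) simp
qed

section \<open>Secondary divisors and the generating function\<close>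

text \<open>Measured from the apex, the coefficient of an integer point \<open>x\<close> along the
  ray \<open>z v\<close> is \<open>psi n E D x $ v\<close> divided by \<open>l v\<close>; it is
  below 1 iff the divisor is below \<open>l v\<close> at \<open>v\<close>.\<close>

lemma integer_points_parallelepiped:
  assumes D: "D \<in> carrier_vec n" "div_degree D = 0"
    and z: "\<And>v. v < n \<Longrightarrow> z v \<in> carrier_vec n"
      "\<And>v. v < n \<Longrightarrow> M *\<^sub>v z v = int (l v) \<cdot>\<^sub>v unit_vec n v"
    and l: "\<And>v. v < n \<Longrightarrow> 0 < l v"
  shows "integer_points (fundamental_parallelepiped n (cone_apex n E D) (z ` {..<n})) =
    {x \<in> integer_points (cone_K n E D). \<forall>v<n. psi n E D x $ v < int (l v)}"
proof -
  let ?w = "\<lambda>v. real_vec (z v)" and ?m = "\<lambda>v. real (l v)"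
  let ?B = "map_mat real_of_int M"
  have w: "\<And>v. v < n \<Longrightarrow> ?w v \<in> carrier_vec n"
      "\<And>v. v < n \<Longrightarrow> ?B *\<^sub>v ?w v = ?m v \<cdot>\<^sub>v unit_vec n v"
      "\<And>v. v < n \<Longrightarrow> 0 < ?m v"
    using z integral_rays_real l by auto
  have img: "real_vec ` z ` {..<n} = ?w ` {..<n}"
    by (simp only: image_image)
  have P: "fundamental_parallelepiped n (cone_apex n E D) (z ` {..<n}) =
      {x \<in> carrier_vec n. \<forall>i<n. 0 \<le> ((?B *\<^sub>v x) $ i - (- real_vec D) $ i) / ?m i
        \<and> ((?B *\<^sub>v x) $ i - (- real_vec D) $ i) / ?m i < 1}"
    unfolding fundamental_parallelepiped_def img
    by (rule box_eq [OF w cone_apex [OF D], of "\<lambda>t. 0 \<le> t \<and> t < 1"])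
  have iff: "0 \<le> ((?B *\<^sub>v real_vec x) $ i - (- real_vec D) $ i) / ?m i
      \<and> ((?B *\<^sub>v real_vec x) $ i - (- real_vec D) $ i) / ?m i < 1 \<longleftrightarrow>
      0 \<le> psi n E D x $ i \<and> psi n E D x $ i < int (l i)" if x: "x \<in> carrier_vec n" and i: "i < n" for x i
  proof -
    have "(?B *\<^sub>v real_vec x) $ i - (- real_vec D) $ i = real_of_int (psi n E D x $ i)"
      using D x i by (simp add: mult_M_real_index psi_eq)
    then show ?thesis
      using w(3) [OF i] by (simp add: pos_le_divide_eq pos_divide_less_eq) linarith
  qed
  show ?thesis
  proof (rule Set.set_eqI)
    fix x
    show "x \<in> integer_points (fundamental_parallelepiped n (cone_apex n E D) (z ` {..<n})) \<longleftrightarrow>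
      x \<in> {x \<in> integer_points (cone_K n E D). \<forall>v<n. psi n E D x $ v < int (l v)}"
    proof (cases "x \<in> carrier_vec n")
      case True
      then show ?thesis
        unfolding integer_points_cone_K [OF D(1)] unfolding P integer_points_def using iff [OF True] by auto
    next
      case False
      then show ?thesis
        unfolding integer_points_cone_K [OF D(1)] unfolding P integer_points_def by simp
    qed
  qed
qed

text \<open>The primary divisor is the image of an integral vector \<open>z\<close>. Adding it
  translates \<open>x\<close> by \<open>z\<close>, and both divisors are effective because
  \<open>F\<close> is.\<close>

lemma effective_class_shift:
  assumes D: "D \<in> carrier_vec n" "div_degree D = 0" and l: "primary_multiplicities n E l"
    and F: "F \<in> carrier_vec n" "\<And>i. i < n \<Longrightarrow> 0 \<le> F $ i" and v: "v < n"
  shows "F + int (l v) \<cdot>\<^sub>v unit_vec n v \<in> effective_class n E D \<longleftrightarrow> F \<in> effective_class n E D"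
proof -
  obtain z where z: "z \<in> carrier_vec n" "M *\<^sub>v z = int (l v) \<cdot>\<^sub>v unit_vec n v"
    using l v ord_q_dvd_iff [OF v, of "l v"] unfolding primary_multiplicities_def by blast
  have mem: "G \<in> effective_class n E D \<longleftrightarrow> (\<exists>x\<in>carrier_vec n. G = D + M *\<^sub>v x)"
    if "\<And>i. i < n \<Longrightarrow> 0 \<le> G $ i" for G
    using that D by (auto simp: effective_class_eq integer_points_cone_K psi_eq image_iff)
  have "0 \<le> (F + int (l v) \<cdot>\<^sub>v unit_vec n v) $ i" if "i < n" for i
    using F that v by simp
  note mem1 = mem [OF this] and mem2 = mem [OF F(2)]
  have "(\<exists>x\<in>carrier_vec n. F + int (l v) \<cdot>\<^sub>v unit_vec n v = D + M *\<^sub>v x) \<longleftrightarrow>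
      (\<exists>x\<in>carrier_vec n. F = D + M *\<^sub>v x)"
  proof
    assume "\<exists>x\<in>carrier_vec n. F + int (l v) \<cdot>\<^sub>v unit_vec n v = D + M *\<^sub>v x"
    then obtain x where x: "x \<in> carrier_vec n" "F + int (l v) \<cdot>\<^sub>v unit_vec n v = D + M *\<^sub>v x"
      by blast
    have "F = D + M *\<^sub>v (x - z)"
    proof (rule eq_vecI)
      fix i assume "i < dim_vec (D + M *\<^sub>v (x - z))"
      then have i: "i < n" by simp
      have "(M *\<^sub>v (x - z)) $ i = (M *\<^sub>v x) $ i - (M *\<^sub>v z) $ i"
        using mult_minus_distrib_mat_vec [OF cone_mat_carrier(1) x(1) z(1), of E] i by simp
      then show "F $ i = (D + M *\<^sub>v (x - z)) $ i"
        using arg_cong [OF x(2), of "\<lambda>y. y $ i"] i F(1) z(2) by simp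
    qed (use F in simp)
    then show "\<exists>x\<in>carrier_vec n. F = D + M *\<^sub>v x"
      using x(1) z(1) by (intro bexI [of _ "x - z"]) auto
  next
    assume "\<exists>x\<in>carrier_vec n. F = D + M *\<^sub>v x"
    then obtain x where x: "x \<in> carrier_vec n" "F = D + M *\<^sub>v x"
      by blast
    have "F + int (l v) \<cdot>\<^sub>v unit_vec n v = D + M *\<^sub>v (x + z)"
      unfolding x(2) z(2) [symmetric]
      using mult_add_distrib_mat_vec [OF cone_mat_carrier(1) x(1) z(1), of E] D by simp
    then show "\<exists>x\<in>carrier_vec n. F + int (l v) \<cdot>\<^sub>v unit_vec n v = D + M *\<^sub>v x"
      using x(1) z(1) by (intro bexI [of _ "x + z"]) auto
  qed
  then show ?thesis
    by (simp only: mem1 mem2)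
qed

text \<open>The bounds on the coefficients bound the degree by the sum of the multiplicities, and
  each degree occurs finitely often.\<close>

lemma finite_secondary_divisors:
  assumes D: "D \<in> carrier_vec n" "div_degree D = 0"
  shows "finite (secondary_divisors n E D l)"
proof (rule finite_subset)
  show "finite (\<Union>k\<le>\<Sum>v<n. l v. {F \<in> effective_class n E D. nat (div_degree F) = k})"
    using finite_effective_class_fiber [OF D] by blast
  show "secondary_divisors n E D l \<subseteq> (\<Union>k\<le>\<Sum>v<n. l v. {F \<in> effective_class n E D. nat (div_degree F) = k})"
  proof
    fix F assume F: "F \<in> secondary_divisors n E D l"
    then have c: "F \<in> carrier_vec n" "F \<in> effective_class n E D"
      using effective_class_carrier(1) [OF D] by (auto simp: secondary_divisors_def)
    have "div_degree F \<le> (\<Sum>v<n. int (l v))"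
      unfolding div_degree_eq [OF c(1)] using F
      by (intro sum_mono) (auto simp: secondary_divisors_def intro: less_imp_le)
    then have "nat (div_degree F) \<le> (\<Sum>v<n. l v)"
      by (simp add: nat_le_iff)
    then show "F \<in> (\<Union>k\<le>\<Sum>v<n. l v. {F \<in> effective_class n E D. nat (div_degree F) = k})"
      using c(2) by blast
  qed
qed

lemma count_series_effective_class:
  assumes D: "D \<in> carrier_vec n" "div_degree D = 0" and l: "primary_multiplicities n E l"
  shows "count_series (\<lambda>F. nat (div_degree F)) (effective_class n E D) * (\<Prod>v<n. 1 - fps_X ^ l v) =
    count_series (\<lambda>F. nat (div_degree F)) (secondary_divisors n E D l)"
  unfolding secondary_divisors_def
proof (rule count_series_box)
  show "effective_class n E D \<subseteq> carrier_vec n"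
    using effective_class_carrier(1) [OF D] by blast
qed (use effective_class_carrier(2) [OF D] effective_class_shift [OF D l]
    finite_effective_class_fiber [OF D] in auto)

end

theorem theorem4p3:
  fixes n :: nat and E :: "nat set multiset" and D :: "int vec"
  assumes "connected_multigraph n E"
    and "D \<in> divisors n"
    and "div_degree D = 0"
  shows "invertible_mat (map_mat real_of_int (reduced_laplacian n E))
    \<and> rational_simplicial_cone n (cone_apex n E D) (cone_K n E D)
    \<and> bij_betw (psi n E D) (integer_points (cone_K n E D)) (effective_class n E D)
    \<and> bij_betw (\<lambda>\<Omega>. psi n E (0\<^sub>v n) ` \<Omega>)
        {\<Omega>. integral_extreme_generators n (cone_K n E D) \<Omega>}
        {primary_set n l | l. primary_multiplicities n E l}
    \<and> Lambda_series n E D = integer_point_transform n (cone_K n E D) (ones_z n)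
    \<and> (\<forall>\<Omega> l P. integral_extreme_generators n (cone_K n E D) \<Omega>
          \<and> primary_multiplicities n E l
          \<and> psi n E (0\<^sub>v n) ` \<Omega> = primary_set n l
          \<and> P = fundamental_parallelepiped n (cone_apex n E D) \<Omega> \<longrightarrow>
        bij_betw (psi n E (0\<^sub>v n)) \<Omega> (primary_set n l)
        \<and> bij_betw (psi n E D) (integer_points P) (secondary_divisors n E D l)
        \<and> integer_point_transform n (cone_K n E D) (ones_z n) =
            integer_point_transform n P (ones_z n)
              / (\<Prod>\<omega> \<in> \<Omega>. 1 - fps_X ^ nat (ray_degree n E \<omega>))
        \<and> integer_point_transform n P (ones_z n) =
            (\<Sum>F \<in> secondary_divisors n E D l. fps_X ^ nat (div_degree F))
        \<and> (\<Prod>\<omega> \<in> \<Omega>. 1 - fps_X ^ nat (ray_degree n E \<omega>) :: rat fps) =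
            (\<Prod>v < n. 1 - fps_X ^ l v))"
proof -
  interpret conn_multigraph n E
    by unfold_locales (rule assms(1))
  have D: "D \<in> carrier_vec n" "div_degree D = 0"
    using assms by (auto simp: divisors_def)
  let ?h = "\<lambda>F. nat (div_degree F)"
  have K: "integer_points (cone_K n E D) \<subseteq> carrier_vec n"
    using integer_points_cone_K [OF D(1)] by blast
  have bij: "bij_betw (psi n E D) (integer_points (cone_K n E D)) (effective_class n E D)"
    unfolding bij_betw_def using effective_class_eq [OF D] inj_on_subset [OF psi_inj [OF D(1)] K] by simp
  have transform_K: "integer_point_transform n (cone_K n E D) (ones_z n) =
      count_series ?h (effective_class n E D)"
    unfolding effective_class_eq [OF D] by (rule transform_eq_count_series [OF D order_refl])
  have main: "bij_betw (psi n E (0\<^sub>v n)) \<Omega> (primary_set n l)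
      \<and> bij_betw (psi n E D) (integer_points P) (secondary_divisors n E D l)
      \<and> integer_point_transform n (cone_K n E D) (ones_z n) =
          integer_point_transform n P (ones_z n)
            / (\<Prod>\<omega> \<in> \<Omega>. 1 - fps_X ^ nat (ray_degree n E \<omega>))
      \<and> integer_point_transform n P (ones_z n) =
          (\<Sum>F \<in> secondary_divisors n E D l. fps_X ^ nat (div_degree F))
      \<and> (\<Prod>\<omega> \<in> \<Omega>. 1 - fps_X ^ nat (ray_degree n E \<omega>) :: rat fps) =
          (\<Prod>v < n. 1 - fps_X ^ l v)"
    if gen: "integral_extreme_generators n (cone_K n E D) \<Omega>"
      and l: "primary_multiplicities n E l"
      and img: "psi n E (0\<^sub>v n) ` \<Omega> = primary_set n l"
      and P: "P = fundamental_parallelepiped n (cone_apex n E D) \<Omega>" for \<Omega> l P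
  proof -
    have \<Omega>: "\<Omega> \<subseteq> carrier_vec n"
      by (rule integral_extreme_generators_carrier [OF gen])
    have pos: "\<And>v. v < n \<Longrightarrow> 0 < l v"
      using l by (simp add: primary_multiplicities_def)
    obtain z where z: "\<Omega> = z ` {..<n}" "inj_on z {..<n}" "\<And>v. v < n \<Longrightarrow> z v \<in> carrier_vec n"
        "\<And>v. v < n \<Longrightarrow> M *\<^sub>v z v = int (l v) \<cdot>\<^sub>v unit_vec n v"
      \<comment> \<open>The indexing by vertices turns products over the rays into products over
        vertices.\<close>
      using primary_set_rays [OF \<Omega> img pos] by blast
    have IP: "integer_points P = {x \<in> integer_points (cone_K n E D). \<forall>v<n. psi n E D x $ v < int (l v)}"
      unfolding P z(1) by (rule integer_points_parallelepiped [OF D z(3,4) pos])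
    then have IPK: "integer_points P \<subseteq> integer_points (cone_K n E D)"
      by blast
    have psi_P: "psi n E D ` integer_points P = secondary_divisors n E D l"
      unfolding IP secondary_divisors_def effective_class_eq [OF D] by blast
    have bij1: "bij_betw (psi n E (0\<^sub>v n)) \<Omega> (primary_set n l)"
      unfolding bij_betw_def using img inj_on_subset [OF psi_inj [OF zero_carrier_vec] \<Omega>] by simp
    have bij2: "bij_betw (psi n E D) (integer_points P) (secondary_divisors n E D l)"
      unfolding bij_betw_def using psi_P inj_on_subset [OF psi_inj [OF D(1)]] IPK K by blast
    have transform_P: "integer_point_transform n P (ones_z n) =
        count_series ?h (secondary_divisors n E D l)"
      unfolding psi_P [symmetric] by (rule transform_eq_count_series [OF D IPK])
    have deg: "ray_degree n E (z v) = int (l v)" if "v < n" for v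
      unfolding ray_degree_def psi_zero [OF z(3) [OF that]] z(4) [OF that]
      by (rule div_degree_smult_unit [OF that])
    have den: "(\<Prod>\<omega> \<in> \<Omega>. 1 - fps_X ^ nat (ray_degree n E \<omega>) :: rat fps) = (\<Prod>v<n. 1 - fps_X ^ l v)"
      unfolding z(1) prod.reindex [OF z(2)] by (intro prod.cong) (auto simp: deg)
    \<comment> \<open>Each factor has constant coefficient 1 because \<open>l v\<close> is positive.
      So the product is nonzero and can be cancelled.\<close>
    have nz: "(\<Prod>v<n. 1 - fps_X ^ l v :: rat fps) \<noteq> 0"
    proof -
      have "(1 - fps_X ^ l v :: rat fps) \<noteq> 0" if "v < n" for v
        using pos [OF that] by (auto simp: fps_eq_iff fps_X_power_nth intro!: exI [of _ 0])
      then show ?thesis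
        by auto
    qed
    have "integer_point_transform n (cone_K n E D) (ones_z n) =
        integer_point_transform n P (ones_z n) / (\<Prod>v<n. 1 - fps_X ^ l v)"
      unfolding transform_K transform_P count_series_effective_class [OF D l, symmetric]
      using nz by simp
    moreover have "integer_point_transform n P (ones_z n) =
        (\<Sum>F \<in> secondary_divisors n E D l. fps_X ^ nat (div_degree F))"
      unfolding transform_P by (rule count_series_finite [OF finite_secondary_divisors [OF D]])
    ultimately show ?thesis
      using bij1 bij2 den by simp
  qed
  have "invertible_mat (map_mat real_of_int (reduced_laplacian n E))"
    by (rule nonsingular.invertible_B [OF nonsingular_reduced_laplacian])
  moreover have "Lambda_series n E D = integer_point_transform n (cone_K n E D) (ones_z n)"
    unfolding transform_K by (rule Lambda_series_eq [OF D])
  ultimately show ?thesis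
    using rational_simplicial_cone_K [OF D] bij bij_betw_generators_primary_sets [OF D] main by blast
qed

end
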